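(* There is a constant $\beta>0$, independent of $\kappa>0$, such that $$\inf_{(\sigma,u)\in\Sigma\times V}\ \sup_{(\tau,v)\in\Sigma\times V}\ \frac{A((\sigma,u),(\tau,v))}{\bigl(\|\sigma\|_{\Sigma}+\|u\|_{V}\bigr)\bigl(\|\tau\|_{\Sigma}+\|v\|_{V}\bigr)}\ \ge\ \beta,$$ where the infimum and supremum are over nonzero pairs.
   Context: Let $n\in\{2,3\}$, let $\Omega\subset\mathbb{R}^n$ be a bounded, simply connected polygonal (polyhedral) domain with Lipschitz boundary $\Gamma$, and let $\kappa>0$ be a constant; put $\widetilde\kappa=\min\{\kappa,1\}$. $\mathbb{S}$ is the space of real symmetric $n\times n$ matrices. For a matrix $\tau$, $\tau^d=\tau-\frac1n\mathrm{tr}(\tau)I$ is its deviatoric part; $\mathbf{div}$ of a matrix field is taken row by row; $(\cdot,\cdot)$ is the $L^2(\Omega)$ inner product (with the Frobenius product for matrices). Spaces: $\Sigma=\{\tau\in L^2(\Omega;\mathbb{S}):\ \mathbf{div}\,\tau\in L^2(\Omega)^n,\ \int_\Omega\mathrm{tr}(\tau)\,dx=0\}$ and $V=L^2(\Omega)^n$, with norms $$\|\tau\|_{\Sigma}^2=(\tau^d,\tau^d)+\widetilde\kappa\,(\mathbf{div}\,\tau,\mathbf{div}\,\tau),\qquad \|v\|_V^2=\widetilde\kappa^{-1}(v,v).$$ Bilinear form on $(\Sigma\times V)\times(\Sigma\times V)$: $$A((\sigma,u),(\tau,v))=\tfrac12(\sigma^d,\tau^d)+(\mathbf{div}\,\tau,u)-(\mathbf{div}\,\sigma,v)+(\kappa^{-1}u,v).$$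 *)

theory Defs
  imports "HOL-Analysis.Analysis"
begin

section \<open>Polyhedral Lipschitz domains\<close>

text \<open>
  Locally, in suitable orthogonal coordinates, \<open>\<Omega>\<close> is the set below the graph of a Lipschitz
  function. The unit vector \<open>e\<close> is the vertical direction, \<open>y - (y \<bullet> e) *\<^sub>R e\<close> are the
  horizontal coordinates of \<open>y\<close>, and \<open>g\<close> is a function on the hyperplane orthogonal to \<open>e\<close>.
\<close>

definition lipschitz_boundary :: "'a::euclidean_space set \<Rightarrow> bool" where
  "lipschitz_boundary \<Omega> \<longleftrightarrow>
     (\<forall>x\<in>frontier \<Omega>. \<exists>U e g L.
        open U \<and> x \<in> U \<and> norm e = 1 \<and> L-lipschitz_on {y. y \<bullet> e = 0} (g :: 'a \<Rightarrow> real) \<and>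
        \<Omega> \<inter> U = {y \<in> U. y \<bullet> e < g (y - (y \<bullet> e) *\<^sub>R e)} \<and>
        frontier \<Omega> \<inter> U = {y \<in> U. y \<bullet> e = g (y - (y \<bullet> e) *\<^sub>R e)})"

text \<open>
  The faces may be nonconvex; they are cut into finitely many convex polytopes of codimension 1.
\<close>

definition polyhedral_boundary :: "'a::euclidean_space set \<Rightarrow> bool" where
  "polyhedral_boundary \<Omega> \<longleftrightarrow>
     (\<exists>F. finite F \<and> (\<forall>P\<in>F. polytope P \<and> aff_dim P = int DIM('a) - 1) \<and> frontier \<Omega> = \<Union>F)"

definition polyhedral_lipschitz_domain :: "'a::euclidean_space set \<Rightarrow> bool" where
  "polyhedral_lipschitz_domain \<Omega> \<longleftrightarrow>
     open \<Omega> \<and> connected \<Omega> \<and> \<Omega> \<noteq> {} \<and> bounded \<Omega> \<and>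
     polyhedral_boundary \<Omega> \<and> lipschitz_boundary \<Omega>"

section \<open>Square integrable fields\<close>

text \<open>
  Elements of Lebesgue and Sobolev spaces are represented by functions; only the values almost
  everywhere in \<open>\<Omega>\<close> matter. On \<^typ>\<open>real^'n^'n\<close> the inner product \<open>\<bullet>\<close> is the Frobenius product.
\<close>

definition L2 :: "'a::euclidean_space set \<Rightarrow> ('a \<Rightarrow> 'b::euclidean_space) set" where
  "L2 \<Omega> = {f \<in> borel_measurable (lebesgue_on \<Omega>).
              integrable (lebesgue_on \<Omega>) (\<lambda>x. (norm (f x))\<^sup>2)}"

definition L2_inner ::
    "'a::euclidean_space set \<Rightarrow> ('a \<Rightarrow> 'b::euclidean_space) \<Rightarrow> ('a \<Rightarrow> 'b) \<Rightarrow> real" where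
  "L2_inner \<Omega> f g = (LINT x|lebesgue_on \<Omega>. f x \<bullet> g x)"

section \<open>Weak row-wise divergence\<close>

definition partial_deriv :: "'n::finite \<Rightarrow> (real^'n \<Rightarrow> real) \<Rightarrow> real^'n \<Rightarrow> real" where
  "partial_deriv i \<phi> x = frechet_derivative \<phi> (at x) (axis i 1)"

definition grad :: "(real^'n::finite \<Rightarrow> real) \<Rightarrow> real^'n \<Rightarrow> real^'n" where
  "grad \<phi> x = (\<chi> i. partial_deriv i \<phi> x)"

primrec C_k :: "nat \<Rightarrow> (real^'n::finite \<Rightarrow> real) \<Rightarrow> bool" where
  "C_k 0 \<phi> \<longleftrightarrow> continuous_on UNIV \<phi>"
| "C_k (Suc k) \<phi> \<longleftrightarrow> \<phi> differentiable_on UNIV \<and> (\<forall>i. C_k k (partial_deriv i \<phi>))"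

definition test_functions :: "(real^'n::finite) set \<Rightarrow> (real^'n \<Rightarrow> real) set" where
  "test_functions \<Omega> =
     {\<phi>. (\<forall>k. C_k k \<phi>) \<and> compact (closure {x. \<phi> x \<noteq> 0}) \<and> closure {x. \<phi> x \<noteq> 0} \<subseteq> \<Omega>}"

definition has_weak_div ::
    "(real^'n::finite) set \<Rightarrow> (real^'n \<Rightarrow> real^'n) \<Rightarrow> (real^'n \<Rightarrow> real) \<Rightarrow> bool" where
  "has_weak_div \<Omega> q d \<longleftrightarrow>
     (\<forall>\<phi>\<in>test_functions \<Omega>.
        (LINT x|lebesgue_on \<Omega>. q x \<bullet> grad \<phi> x) = - (LINT x|lebesgue_on \<Omega>. d x * \<phi> x))"

definition has_L2_row_div ::
    "(real^'n::finite) set \<Rightarrow> (real^'n \<Rightarrow> real^'n^'n) \<Rightarrow> (real^'n \<Rightarrow> real^'n) \<Rightarrow> bool" where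
  "has_L2_row_div \<Omega> \<tau> g \<longleftrightarrow>
     g \<in> L2 \<Omega> \<and> (\<forall>i. has_weak_div \<Omega> (\<lambda>x. \<tau> x $ i) (\<lambda>x. g x $ i))"

text \<open>
  The weak divergence is unique up to null sets, so the choice below only picks a representative.
\<close>

definition row_div ::
    "(real^'n::finite) set \<Rightarrow> (real^'n \<Rightarrow> real^'n^'n) \<Rightarrow> real^'n \<Rightarrow> real^'n" where
  "row_div \<Omega> \<tau> = (SOME g. has_L2_row_div \<Omega> \<tau> g)"

section \<open>Spaces, norms and the bilinear form\<close>

definition dev :: "real^'n^'n \<Rightarrow> real^'n^'n" where
  "dev \<tau> = \<tau> - (trace \<tau> / real CARD('n)) *\<^sub>R mat 1"

definition stress_space :: "(real^'n::finite) set \<Rightarrow> (real^'n \<Rightarrow> real^'n^'n) set" where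
  "stress_space \<Omega> =
     {\<tau> \<in> L2 \<Omega>. (AE x in lebesgue_on \<Omega>. transpose (\<tau> x) = \<tau> x) \<and>
                 (\<exists>g. has_L2_row_div \<Omega> \<tau> g) \<and>
                 (LINT x|lebesgue_on \<Omega>. trace (\<tau> x)) = 0}"

definition velocity_space :: "(real^'n::finite) set \<Rightarrow> (real^'n \<Rightarrow> real^'n) set" where
  "velocity_space \<Omega> = L2 \<Omega>"

definition kappa_tilde :: "real \<Rightarrow> real" where
  "kappa_tilde \<kappa> = min \<kappa> 1"

definition stress_norm ::
    "real \<Rightarrow> (real^'n::finite) set \<Rightarrow> (real^'n \<Rightarrow> real^'n^'n) \<Rightarrow> real" where
  "stress_norm \<kappa> \<Omega> \<tau> =
     sqrt (L2_inner \<Omega> (\<lambda>x. dev (\<tau> x)) (\<lambda>x. dev (\<tau> x)) +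
           kappa_tilde \<kappa> * L2_inner \<Omega> (row_div \<Omega> \<tau>) (row_div \<Omega> \<tau>))"

definition velocity_norm ::
    "real \<Rightarrow> (real^'n::finite) set \<Rightarrow> (real^'n \<Rightarrow> real^'n) \<Rightarrow> real" where
  "velocity_norm \<kappa> \<Omega> v = sqrt (inverse (kappa_tilde \<kappa>) * L2_inner \<Omega> v v)"

definition A_form ::
    "real \<Rightarrow> (real^'n::finite) set \<Rightarrow>
     (real^'n \<Rightarrow> real^'n^'n) \<times> (real^'n \<Rightarrow> real^'n) \<Rightarrow>
     (real^'n \<Rightarrow> real^'n^'n) \<times> (real^'n \<Rightarrow> real^'n) \<Rightarrow> real" where
  "A_form \<kappa> \<Omega> = (\<lambda>(\<sigma>, u) (\<tau>, v).
     1/2 * L2_inner \<Omega> (\<lambda>x. dev (\<sigma> x)) (\<lambda>x. dev (\<tau> x))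
     + L2_inner \<Omega> (row_div \<Omega> \<tau>) u
     - L2_inner \<Omega> (row_div \<Omega> \<sigma>) v
     + L2_inner \<Omega> (\<lambda>x. inverse \<kappa> *\<^sub>R u x) v)"

definition pair_norm ::
    "real \<Rightarrow> (real^'n::finite) set \<Rightarrow>
     (real^'n \<Rightarrow> real^'n^'n) \<times> (real^'n \<Rightarrow> real^'n) \<Rightarrow> real" where
  "pair_norm \<kappa> \<Omega> = (\<lambda>(\<tau>, v). stress_norm \<kappa> \<Omega> \<tau> + velocity_norm \<kappa> \<Omega> v)"

text \<open>A pair is nonzero as an element of the product space if it does not vanish almost everywhere.\<close>

definition nonzero_pairs ::
    "(real^'n::finite) set \<Rightarrow>
     ((real^'n \<Rightarrow> real^'n^'n) \<times> (real^'n \<Rightarrow> real^'n)) set" where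
  "nonzero_pairs \<Omega> =
     {(\<tau>, v). \<tau> \<in> stress_space \<Omega> \<and> v \<in> velocity_space \<Omega> \<and>
               \<not> (AE x in lebesgue_on \<Omega>. \<tau> x = 0 \<and> v x = 0)}"

end

theory Submission
  imports Defs
begin

text \<open>
  The inf-sup condition is proved with an explicit test pair. Put \<open>k = min \<kappa> 1\<close>. Given \<open>(\<sigma>, u)\<close>, take
  \<open>\<tau> = \<sigma> + \<delta> \<rho>\<close> and \<open>v = u - k div \<sigma>\<close>, where \<open>\<rho>\<close> is a stress with \<open>div \<rho> = u\<close> whose deviator is
  bounded by \<open>u\<close>, and \<open>\<delta>\<close> is small. The coupling terms of \<open>(\<sigma>, u)\<close> with itself cancel, which leaves the
  squared norm of \<open>dev \<sigma>\<close> and \<open>1 / \<kappa>\<close> times that of \<open>u\<close>. The correction of \<open>v\<close> adds \<open>k\<close> times the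
  squared norm of \<open>div \<sigma>\<close>, and the correction of \<open>\<tau>\<close> adds \<open>\<delta>\<close> times the squared norm of \<open>u\<close>; the
  new mixed terms are absorbed. The last contribution makes the constant uniform: the velocity norm has the
  weight \<open>1 / k\<close>, which is \<open>1 / \<kappa>\<close> for \<open>\<kappa> \<le> 1\<close> and 1 for \<open>\<kappa> > 1\<close>. The computation is
  \<open>stable_test_pair\<close>, and it rests on two facts about weak divergences.

  First, the divergence has a bounded right inverse into symmetric fields
  (\<open>symmetric_right_inverse_of_divergence\<close>). As there is no boundary condition, one may extend \<open>u\<close> by zero and
  integrate each component along its own axis: the diagonal matrix of these antiderivatives has row-wise
  divergence \<open>u\<close>. The integral along a ray, written as an integral of translates, is handled by Fubini and the
  translation invariance of Lebesgue measure.

  Second, the norms are definite (\<open>energy_pos\<close>). If the deviator and the divergence of \<open>\<sigma>\<close> vanish, \<open>\<sigma>\<close>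
  is a multiple \<open>p\<close> of the identity with vanishing weak gradient, so \<open>p\<close> is constant and, its mean being zero,
  vanishes. That \<open>p\<close> is constant is seen on small cubes: smooth bumps approximate indicators of boxes, the
  difference of two translated bumps is a partial derivative of a test function, hence the integrals of \<open>p\<close> over
  translated cubes agree, and Lebesgue's differentiation theorem recovers the values of \<open>p\<close>. The same
  approximation shows that weak divergences are unique.
\<close>

section \<open>Smooth cut-off functions\<close>

text \<open>
  With \<open>p = 1\<close> this is the flat function \<open>exp (- 1 / t)\<close>. The polynomial factor makes the family closed under
  differentiation, so that smoothness of all members follows from one derivative formula.
\<close>

definition flat_exp :: "real poly \<Rightarrow> real \<Rightarrow> real" where
  "flat_exp p t = (if t > 0 then poly p (1 / t) * exp (- (1 / t)) else 0)"

lemma poly_times_exp_tendsto_0: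
  fixes p :: "real poly"
  shows "((\<lambda>s. poly p s * exp (- s)) \<longlongrightarrow> 0) at_top"
proof -
  have "((\<lambda>s. \<Sum>i\<le>degree p. coeff p i * (s ^ i / exp s)) \<longlongrightarrow> (\<Sum>i\<le>degree p. coeff p i * 0)) at_top"
    by (intro tendsto_intros tendsto_power_div_exp_0)
  then show ?thesis
    by (simp add: poly_altdef sum_distrib_right exp_minus divide_inverse mult.assoc)
qed

text \<open>
  Away from 0 this is the product rule. At 0 the right difference quotient becomes
  \<open>s * poly p s * exp (- s)\<close> under \<open>s = 1 / h\<close>, and the exponential beats every polynomial as \<open>s\<close> tends
  to infinity.
\<close>

lemma flat_exp_has_derivative:
  "(flat_exp p has_real_derivative flat_exp ([:0, 0, 1:] * (p - pderiv p)) t) (at t)"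
proof (cases t "0 :: real" rule: linorder_cases)
  case less
  have "\<forall>\<^sub>F s in nhds t. s < 0"
    using less by (rule eventually_nhds_in_open[OF open_lessThan, simplified])
  then have ev: "\<forall>\<^sub>F s in nhds t. flat_exp p s = 0"
    by eventually_elim (simp add: flat_exp_def)
  show ?thesis
    using less by (subst DERIV_cong_ev[OF refl ev refl]) (simp add: flat_exp_def)
next
  case greater
  have "\<forall>\<^sub>F s in nhds t. 0 < s"
    using greater by (rule eventually_nhds_in_open[OF open_greaterThan, simplified])
  then have ev: "\<forall>\<^sub>F s in nhds t. flat_exp p s = poly p (1 / s) * exp (- (1 / s))"
    by eventually_elim (simp add: flat_exp_def)
  show ?thesis
    using greater
    by (subst DERIV_cong_ev[OF refl ev refl], auto simp: flat_exp_def
       intro!: derivative_eq_intros DERIV_chain2[OF poly_DERIV])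
       (simp add: field_simps power2_eq_square)
next
  case equal
  have "((\<lambda>s. poly ([:0, 1:] * p) s * exp (- s)) \<longlongrightarrow> 0) at_top"
    by (rule poly_times_exp_tendsto_0)
  then have "((\<lambda>h. poly ([:0, 1:] * p) (inverse h) * exp (- inverse h)) \<longlongrightarrow> 0) (at_right 0)"
    by (rule filterlim_compose[OF _ filterlim_inverse_at_top_right])
  moreover have "\<forall>\<^sub>F h in at_right (0::real).
      poly ([:0, 1:] * p) (inverse h) * exp (- inverse h) = (flat_exp p (0 + h) - flat_exp p 0) / h"
    unfolding eventually_at_right_field
    by (intro exI[of _ 1]) (auto simp: flat_exp_def field_simps)
  ultimately have "((\<lambda>h. (flat_exp p (0 + h) - flat_exp p 0) / h) \<longlongrightarrow> 0) (at_right 0)"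
    by (rule Lim_transform_eventually)
  moreover have "\<forall>\<^sub>F h in at_left (0::real). 0 = (flat_exp p (0 + h) - flat_exp p 0) / h"
    unfolding eventually_at_left_field
    by (intro exI[of _ "-1"]) (auto simp: flat_exp_def field_simps)
  then have "((\<lambda>h. (flat_exp p (0 + h) - flat_exp p 0) / h) \<longlongrightarrow> 0) (at_left 0)"
    by (rule Lim_transform_eventually[OF tendsto_const])
  ultimately show ?thesis
    using equal by (simp add: DERIV_def filterlim_split_at flat_exp_def)
qed

primrec diff_times :: "nat \<Rightarrow> (real \<Rightarrow> real) \<Rightarrow> bool" where
  "diff_times 0 f \<longleftrightarrow> True"
| "diff_times (Suc k) f \<longleftrightarrow> (\<exists>f'. (\<forall>x. (f has_real_derivative f' x) (at x)) \<and> diff_times k f')"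

definition smooth :: "(real \<Rightarrow> real) \<Rightarrow> bool" where
  "smooth f \<longleftrightarrow> (\<forall>k. diff_times k f)"

lemma diff_times_Suc_imp: "diff_times (Suc k) f \<Longrightarrow> diff_times k f"
  by (induction k arbitrary: f) (simp, metis diff_times.simps(2))

lemma diff_times_add: "diff_times k f \<Longrightarrow> diff_times k g \<Longrightarrow> diff_times k (\<lambda>x. f x + g x)"
proof (induction k arbitrary: f g)
  case (Suc k)
  then obtain f' g' where "\<forall>x. (f has_real_derivative f' x) (at x)" "diff_times k f'"
      "\<forall>x. (g has_real_derivative g' x) (at x)" "diff_times k g'"
    by auto
  then show ?case
    using Suc.IH[of f' g'] by (auto intro!: exI[of _ "\<lambda>x. f' x + g' x"] derivative_intros)
qed simp

lemma diff_times_mult: "diff_times k f \<Longrightarrow> diff_times k g \<Longrightarrow> diff_times k (\<lambda>x. f x * g x)"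
proof (induction k arbitrary: f g)
  case (Suc k)
  then obtain f' g' where *: "\<forall>x. (f has_real_derivative f' x) (at x)" "diff_times k f'"
      "\<forall>x. (g has_real_derivative g' x) (at x)" "diff_times k g'"
    by auto
  have "diff_times k (\<lambda>x. f' x * g x + f x * g' x)"
    using * Suc by (intro diff_times_add Suc.IH diff_times_Suc_imp[of k f] diff_times_Suc_imp[of k g])
  then show ?case
    using * by (auto intro!: exI[of _ "\<lambda>x. f' x * g x + f x * g' x"] derivative_eq_intros)
qed simp

lemma diff_times_const: "diff_times k (\<lambda>_. a)"
  by (induction k arbitrary: a) (auto intro!: derivative_eq_intros exI[of _ "\<lambda>_. 0"])

lemma diff_times_affine: "diff_times k f \<Longrightarrow> diff_times k (\<lambda>x. f (c * x + d))"
proof (induction k arbitrary: f)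
  case (Suc k)
  then obtain f' where *: "\<forall>x. (f has_real_derivative f' x) (at x)" "diff_times k f'"
    by auto
  have "diff_times k (\<lambda>x. c * f' (c * x + d))"
    using * Suc.IH[of f'] by (intro diff_times_mult diff_times_const) auto
  then show ?case
    unfolding diff_times.simps
  proof (intro exI[of _ "\<lambda>x. c * f' (c * x + d)"] conjI allI)
    fix x
    have "((\<lambda>x. c * x + d) has_real_derivative c) (at x)"
      by (auto intro!: derivative_eq_intros)
    from DERIV_chain2[OF *(1)[rule_format] this]
    show "((\<lambda>x. f (c * x + d)) has_real_derivative c * f' (c * x + d)) (at x)"
      by (simp add: mult.commute)
  qed
qed simp

lemma smooth_flat_exp: "smooth (flat_exp p)"
proof -
  have "diff_times k (flat_exp p)" for k
    by (induction k arbitrary: p) (auto intro: flat_exp_has_derivative)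
  then show ?thesis by (simp add: smooth_def)
qed

lemma smooth_mult: "smooth f \<Longrightarrow> smooth g \<Longrightarrow> smooth (\<lambda>x. f x * g x)"
  by (simp add: smooth_def diff_times_mult)

lemma smooth_affine: "smooth f \<Longrightarrow> smooth (\<lambda>x. f (c * x + d))"
  by (simp add: smooth_def diff_times_affine)

lemma smooth_diff:
  assumes "smooth f" "smooth g" shows "smooth (\<lambda>x. f x - g x)"
proof -
  have "smooth (\<lambda>x. -1 :: real)"
    by (simp add: smooth_def diff_times_const)
  from smooth_mult[OF this assms(2)] assms(1) show ?thesis
    unfolding smooth_def using diff_times_add by fastforce
qed

lemma smooth_has_derivative:
  assumes "smooth f"
  shows "(f has_real_derivative deriv f x) (at x)"
proof -
  have "diff_times (Suc 0) f" using assms by (simp only: smooth_def)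
  then obtain f' where "\<forall>x. (f has_real_derivative f' x) (at x)" by auto
  then show ?thesis by (metis DERIV_imp_deriv)
qed

lemma smooth_deriv: assumes "smooth f" shows "smooth (deriv f)"
  unfolding smooth_def
proof
  fix k
  have "diff_times (Suc k) f" using assms by (simp only: smooth_def)
  then obtain f' where "\<forall>x. (f has_real_derivative f' x) (at x)" "diff_times k f'" by auto
  moreover from this have "f' = deriv f" by (metis DERIV_imp_deriv ext)
  ultimately show "diff_times k (deriv f)" by simp
qed

lemma smooth_antiderivative:
  assumes "smooth f" "\<And>x. (F has_real_derivative f x) (at x)"
  shows "smooth F"
  unfolding smooth_def
proof
  fix k show "diff_times k F"
    using assms by (cases k) (auto simp: smooth_def)
qed

lemma smooth_continuous: "smooth f \<Longrightarrow> continuous_on A f"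
  using smooth_has_derivative DERIV_isCont continuous_at_imp_continuous_on by blast

section \<open>Test functions of product form\<close>

lemma prod_has_derivative:
  fixes f :: "'n::finite \<Rightarrow> real \<Rightarrow> real"
  assumes "\<And>j. smooth (f j)"
  shows "((\<lambda>y :: real^'n. \<Prod>j\<in>UNIV. f j (y $ j)) has_derivative
     (\<lambda>h. \<Sum>i\<in>UNIV. (h $ i * deriv (f i) (y $ i)) * (\<Prod>j\<in>UNIV - {i}. f j (y $ j)))) (at y)"
proof (rule has_derivative_prod)
  fix i
  have "(f i has_derivative (\<lambda>t. t * deriv (f i) (y $ i))) (at (y $ i))"
    using smooth_has_derivative[OF assms, of i "y $ i"]
    by (simp add: has_field_derivative_def mult.commute[of _ "deriv _ _"])
  then show "((\<lambda>y. f i (y $ i)) has_derivative (\<lambda>h. h $ i * deriv (f i) (y $ i))) (at y)"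
    using has_derivative_compose[OF bounded_linear_imp_has_derivative[OF bounded_linear_vec_nth]]
    by blast
qed

text \<open>
  Differentiating a product of functions of one coordinate each replaces a single factor by its derivative,
  so the product form is preserved. This reduces smoothness in several variables to smoothness in one.
\<close>

lemma partial_deriv_prod:
  fixes f :: "'n::finite \<Rightarrow> real \<Rightarrow> real"
  assumes "\<And>j. smooth (f j)"
  shows "partial_deriv i (\<lambda>y :: real^'n. \<Prod>j\<in>UNIV. f j (y $ j)) =
         (\<lambda>y. \<Prod>j\<in>UNIV. (f(i := deriv (f i))) j (y $ j))"
proof
  fix y :: "real^'n"
  have "partial_deriv i (\<lambda>y :: real^'n. \<Prod>j\<in>UNIV. f j (y $ j)) y =
    (\<Sum>k\<in>UNIV. ((axis i 1 :: real^'n) $ k * deriv (f k) (y $ k)) * (\<Prod>j\<in>UNIV - {k}. f j (y $ j)))"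
    unfolding partial_deriv_def
    by (subst frechet_derivative_at[OF prod_has_derivative[OF assms], symmetric]) simp
  also have "\<dots> = (\<Sum>k\<in>UNIV. if k = i then deriv (f k) (y $ k) * (\<Prod>j\<in>UNIV - {k}. f j (y $ j)) else 0)"
    by (intro sum.cong) (auto simp: axis_def)
  also have "\<dots> = deriv (f i) (y $ i) * (\<Prod>j\<in>UNIV - {i}. f j (y $ j))"
    by simp
  also have "\<dots> = (\<Prod>j\<in>UNIV. (f(i := deriv (f i))) j (y $ j))"
    by (subst prod.remove[of UNIV i]) (auto intro!: prod.cong)
  finally show "partial_deriv i (\<lambda>y :: real^'n. \<Prod>j\<in>UNIV. f j (y $ j)) y = \<dots>" .
qed

lemma C_k_prod:
  fixes f :: "'n::finite \<Rightarrow> real \<Rightarrow> real"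
  assumes "\<And>j. smooth (f j)"
  shows "C_k k (\<lambda>y :: real^'n. \<Prod>j\<in>UNIV. f j (y $ j))"
  using assms
proof (induction k arbitrary: f)
  case 0
  have "continuous_on UNIV (\<lambda>y :: real^'n. f j (y $ j))" for j
    by (rule continuous_on_compose2[OF smooth_continuous[OF 0, of UNIV]]) (auto intro: continuous_intros)
  then show ?case by (auto intro!: continuous_intros)
next
  case (Suc k)
  have "(\<lambda>y :: real^'n. \<Prod>j\<in>UNIV. f j (y $ j)) differentiable_on UNIV"
    unfolding differentiable_on_def differentiable_def
    using prod_has_derivative[of f, OF Suc.prems] by blast
  moreover have "C_k k (partial_deriv i (\<lambda>y :: real^'n. \<Prod>j\<in>UNIV. f j (y $ j)))" for i
    unfolding partial_deriv_prod[OF Suc.prems]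
    by (rule Suc.IH) (auto intro: smooth_deriv Suc.prems)
  ultimately show ?case by simp
qed

lemma prod_test_function:
  fixes f :: "'n::finite \<Rightarrow> real \<Rightarrow> real" and a b :: "real^'n"
  assumes "\<And>j. smooth (f j)" "\<And>j t. f j t \<noteq> 0 \<Longrightarrow> a $ j \<le> t \<and> t \<le> b $ j" "cbox a b \<subseteq> \<Omega>"
  shows "(\<lambda>y. \<Prod>j\<in>UNIV. f j (y $ j)) \<in> test_functions \<Omega>"
proof -
  have "{y :: real^'n. (\<Prod>j\<in>UNIV. f j (y $ j)) \<noteq> 0} \<subseteq> cbox a b"
    using assms(2) by (auto simp: mem_box_cart)
  then have "closure {y :: real^'n. (\<Prod>j\<in>UNIV. f j (y $ j)) \<noteq> 0} \<subseteq> cbox a b"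
    by (intro closure_minimal closed_cbox)
  then show ?thesis
    using assms C_k_prod[of f] unfolding test_functions_def
    by (auto simp: compact_eq_bounded_closed intro: bounded_subset[OF bounded_cbox])
qed

text \<open>
  \<open>exp (- 1 / t)\<close> tends to 1 as \<open>t\<close> tends to infinity, so increasing \<open>m\<close> drives the bump on \<open>{a<..<b}\<close> to the
  indicator of that interval while its support stays fixed. The dependence on \<open>t - a\<close> and \<open>b - t\<close> alone makes a
  translated bump the bump of the translated interval.
\<close>

definition bump :: "nat \<Rightarrow> real \<Rightarrow> real \<Rightarrow> real \<Rightarrow> real" where
  "bump m a b t = flat_exp 1 (real m * (t - a)) * flat_exp 1 (real m * (b - t))"

lemma smooth_bump: "smooth (bump m a b)"
proof -
  have "smooth (\<lambda>t. flat_exp 1 (real m * t + (- real m * a)) * flat_exp 1 (- real m * t + real m * b))"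
    by (intro smooth_mult smooth_affine smooth_flat_exp)
  then show ?thesis by (simp add: bump_def[abs_def] algebra_simps)
qed

lemma bump_bounds: "0 \<le> bump m a b t" "bump m a b t \<le> 1"
  by (auto simp: bump_def flat_exp_def intro!: mult_le_one)

lemma bump_eq_0: "t \<le> a \<or> b \<le> t \<Longrightarrow> bump m a b t = 0"
  by (auto simp: bump_def flat_exp_def mult_pos_pos zero_less_mult_iff)

lemma bump_tendsto_indicator: "(\<lambda>m. bump m a b t) \<longlonglongrightarrow> indicator {a<..<b} t"
proof (cases "a < t \<and> t < b")
  case True
  have one: "(\<lambda>m. flat_exp 1 (real m * c)) \<longlonglongrightarrow> 1" if "0 < c" for c
  proof -
    have "(\<lambda>m. exp (- (inverse (real m) * inverse c))) \<longlonglongrightarrow> exp (- (0 * inverse c))"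
      by (intro tendsto_intros lim_inverse_n)
    moreover have "\<forall>\<^sub>F m in sequentially. exp (- (inverse (real m) * inverse c)) = flat_exp 1 (real m * c)"
      using eventually_gt_at_top[of 0]
      by eventually_elim (use that in \<open>simp add: flat_exp_def field_simps\<close>)
    ultimately show ?thesis by (simp add: Lim_transform_eventually)
  qed
  have "(\<lambda>m. bump m a b t) \<longlonglongrightarrow> 1 * 1"
    unfolding bump_def using True by (intro tendsto_mult one) auto
  then show ?thesis using True by simp
next
  case False
  then show ?thesis by (subst bump_eq_0) auto
qed

lemma prod_bump_tendsto_indicator:
  fixes a b y :: "real^'n::finite"
  shows "(\<lambda>m. \<Prod>j\<in>UNIV. bump m (a $ j) (b $ j) (y $ j)) \<longlonglongrightarrow> indicator (box a b) y"
proof -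
  have "(\<lambda>m. \<Prod>j\<in>UNIV. bump m (a $ j) (b $ j) (y $ j)) \<longlonglongrightarrow>
        (\<Prod>j\<in>UNIV. indicator {a $ j<..<b $ j} (y $ j))"
    by (intro tendsto_prod bump_tendsto_indicator)
  also have "(\<Prod>j\<in>UNIV. indicator {a $ j<..<b $ j} (y $ j)) = (indicator (box a b) y :: real)"
    by (auto simp: indicator_def mem_box_cart)
  finally show ?thesis .
qed

section \<open>Vanishing weak gradients\<close>

definition zero_ext :: "'a set \<Rightarrow> ('a \<Rightarrow> real) \<Rightarrow> 'a \<Rightarrow> real" where
  "zero_ext \<Omega> f x = (if x \<in> \<Omega> then f x else 0)"

lemma zero_ext_absolutely_integrable:
  fixes \<Omega> S :: "'a::euclidean_space set"
  assumes "open \<Omega>" "integrable (lebesgue_on \<Omega>) f" "S \<in> sets lebesgue"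
  shows "zero_ext \<Omega> f absolutely_integrable_on S"
proof -
  have "f absolutely_integrable_on \<Omega>"
    using assms by (simp add: set_integrable_def integrable_restrict_space)
  then have "zero_ext \<Omega> f absolutely_integrable_on UNIV"
    unfolding zero_ext_def by (subst (asm) absolutely_integrable_restrict_UNIV[symmetric])
  then show ?thesis
    by (rule set_integrable_subset) (use assms(3) in auto)
qed

lemma zero_ext_integrable_on_cbox:
  fixes \<Omega> :: "'a::euclidean_space set"
  assumes "open \<Omega>" "integrable (lebesgue_on \<Omega>) f"
  shows "zero_ext \<Omega> f integrable_on cbox a b"
  by (intro set_lebesgue_integral_eq_integral(1) zero_ext_absolutely_integrable[OF assms]) simp

text \<open>
  Information about integrals against smooth functions passes to integrals over boxes, where Lebesgue's
  differentiation theorem turns it into information about point values.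
\<close>

lemma bump_integral_tendsto_box_integral:
  fixes \<Omega> :: "(real^'n::finite) set"
  assumes \<Omega>: "open \<Omega>" and f: "integrable (lebesgue_on \<Omega>) f" and sub: "cbox a b \<subseteq> \<Omega>"
  shows "(\<lambda>m. LINT x|lebesgue_on \<Omega>. f x * (\<Prod>j\<in>UNIV. bump m (a $ j) (b $ j) (x $ j)))
           \<longlonglongrightarrow> integral (cbox a b) (zero_ext \<Omega> f)"
proof -
  have cont: "continuous_on UNIV (\<lambda>x :: real^'n. \<Prod>j\<in>UNIV. bump m (a $ j) (b $ j) (x $ j))" for m
    using C_k_prod[of "\<lambda>j. bump m (a $ j) (b $ j)" 0] smooth_bump by simp
  have [measurable]: "(\<lambda>x. \<Prod>j\<in>UNIV. bump m (a $ j) (b $ j) (x $ j)) \<in> borel_measurable (lebesgue_on \<Omega>)" for m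
    using \<Omega> by (intro continuous_imp_measurable_on_sets_lebesgue continuous_on_subset[OF cont]) auto
  have [measurable]: "f \<in> borel_measurable (lebesgue_on \<Omega>)" using f by auto
  have [measurable]: "(\<lambda>x. indicator (box a b) x :: real) \<in> borel_measurable (lebesgue_on \<Omega>)"
    by (intro measurable_restrict_space1 borel_measurable_indicator) auto
  have "(\<lambda>m. LINT x|lebesgue_on \<Omega>. f x * (\<Prod>j\<in>UNIV. bump m (a $ j) (b $ j) (x $ j)))
           \<longlonglongrightarrow> (LINT x|lebesgue_on \<Omega>. f x * indicator (box a b) x)"
  proof (rule integral_dominated_convergence[where w = "\<lambda>x. norm (f x)"])
    show "AE x in lebesgue_on \<Omega>. (\<lambda>m. f x * (\<Prod>j\<in>UNIV. bump m (a $ j) (b $ j) (x $ j)))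
         \<longlonglongrightarrow> f x * indicator (box a b) x"
      by (intro AE_I2 tendsto_mult tendsto_const prod_bump_tendsto_indicator)
    show "AE x in lebesgue_on \<Omega>. norm (f x * (\<Prod>j\<in>UNIV. bump m (a $ j) (b $ j) (x $ j))) \<le> norm (f x)" for m
    proof (rule AE_I2)
      fix x
      define P where "P = (\<Prod>j\<in>UNIV. bump m (a $ j) (b $ j) (x $ j))"
      have "0 \<le> P" "P \<le> 1"
        by (auto simp: P_def intro!: prod_nonneg prod_le_1 bump_bounds)
      then have "norm (f x * P) \<le> norm (f x)"
        by (simp add: abs_mult mult_left_le)
      then show "norm (f x * (\<Prod>j\<in>UNIV. bump m (a $ j) (b $ j) (x $ j))) \<le> norm (f x)"
        by (simp only: P_def)
    qed
  next
    show "integrable (lebesgue_on \<Omega>) (\<lambda>x. norm (f x))" using f by simp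
  qed measurable
  also have "(LINT x|lebesgue_on \<Omega>. f x * indicator (box a b) x) =
             (LINT x|lebesgue. indicator (box a b) x *\<^sub>R zero_ext \<Omega> f x)"
    using \<Omega> sub box_subset_cbox[of a b]
    by (subst integral_restrict_space)
       (auto intro!: Bochner_Integration.integral_cong simp: zero_ext_def indicator_def)
  also have "\<dots> = integral (box a b) (zero_ext \<Omega> f)"
  proof -
    have "zero_ext \<Omega> f absolutely_integrable_on box a b"
      by (rule zero_ext_absolutely_integrable[OF \<Omega> f]) simp
    from set_lebesgue_integral_eq_integral(2)[OF this]
    show ?thesis by (simp add: set_lebesgue_integral_def)
  qed
  also have "\<dots> = integral (cbox a b) (zero_ext \<Omega> f)"
    by (rule integral_open_interval)
  finally show ?thesis .
qed

lemma One_nth [simp]: "(One :: real^'n::finite) $ j = 1"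
  by (simp add: cart_eq_inner_axis inner_sum_left_Basis axis_in_Basis_iff)

lemma lebesgue_points:
  fixes \<Omega> :: "'a::euclidean_space set"
  assumes "open \<Omega>" "integrable (lebesgue_on \<Omega>) f"
  obtains N where "negligible N"
    "\<And>x. x \<in> \<Omega> \<Longrightarrow> x \<notin> N \<Longrightarrow>
       ((\<lambda>h. integral (cbox x (x + h *\<^sub>R One)) (zero_ext \<Omega> f) /\<^sub>R h ^ DIM('a)) \<longlongrightarrow> f x) (at_right 0)"
proof -
  obtain N where N: "negligible N" "\<And>x e. \<lbrakk>x \<notin> N; 0 < e\<rbrakk> \<Longrightarrow>
       \<exists>d>0. \<forall>h. 0 < h \<and> h < d \<longrightarrow>
         norm (integral (cbox x (x + h *\<^sub>R One)) (zero_ext \<Omega> f) /\<^sub>R h ^ DIM('a) - zero_ext \<Omega> f x) < e"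
    using integrable_ccontinuous_explicit[OF zero_ext_integrable_on_cbox[OF assms]] by blast
  show thesis
  proof (rule that[OF N(1)])
    fix x assume x: "x \<in> \<Omega>" "x \<notin> N"
    show "((\<lambda>h. integral (cbox x (x + h *\<^sub>R One)) (zero_ext \<Omega> f) /\<^sub>R h ^ DIM('a)) \<longlongrightarrow> f x) (at_right 0)"
      unfolding tendsto_iff eventually_at_right_field dist_norm
      using N(2)[OF x(2)] x(1) by (simp add: zero_ext_def) meson
  qed
qed

lemma negligible_AE_lebesgue_on:
  assumes "negligible N" "open \<Omega>" "\<And>x. x \<in> \<Omega> \<Longrightarrow> x \<notin> N \<Longrightarrow> P x"
  shows "AE x in lebesgue_on \<Omega>. P x"
proof -
  have "AE x in lebesgue. x \<notin> N"
    using assms(1) by (simp add: negligible_iff_null_sets AE_not_in)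
  then show ?thesis
    using assms(2,3) by (subst AE_restrict_space_iff) auto
qed

text \<open>
  Products of bumps are test functions, so all integrals of \<open>f\<close> over boxes in \<open>\<Omega>\<close> vanish; hence \<open>f\<close>
  vanishes at each of its Lebesgue points.
\<close>

lemma integral_against_test_functions_zero_imp_AE_zero:
  fixes \<Omega> :: "(real^'n::finite) set"
  assumes \<Omega>: "open \<Omega>" and f: "integrable (lebesgue_on \<Omega>) f"
    and zero: "\<And>\<phi>. \<phi> \<in> test_functions \<Omega> \<Longrightarrow> (LINT x|lebesgue_on \<Omega>. f x * \<phi> x) = 0"
  shows "AE x in lebesgue_on \<Omega>. f x = 0"
proof -
  obtain N where N: "negligible N" "\<And>x. x \<in> \<Omega> \<Longrightarrow> x \<notin> N \<Longrightarrow>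
       ((\<lambda>h. integral (cbox x (x + h *\<^sub>R One)) (zero_ext \<Omega> f) /\<^sub>R h ^ DIM(real^'n)) \<longlongrightarrow> f x) (at_right 0)"
    using lebesgue_points[OF \<Omega> f] by blast
  have box_zero: "integral (cbox a b) (zero_ext \<Omega> f) = 0" if "cbox a b \<subseteq> \<Omega>" for a b
  proof -
    have "(\<lambda>x. \<Prod>j\<in>UNIV. bump m (a $ j) (b $ j) (x $ j)) \<in> test_functions \<Omega>" for m
      using bump_eq_0 by (intro prod_test_function[OF smooth_bump _ that]) (meson linear)
    then have "(LINT x|lebesgue_on \<Omega>. f x * (\<Prod>j\<in>UNIV. bump m (a $ j) (b $ j) (x $ j))) = 0" for m
      by (rule zero)
    then show ?thesis
      using bump_integral_tendsto_box_integral[OF \<Omega> f that] by (simp add: LIMSEQ_const_iff)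
  qed
  show ?thesis
  proof (rule negligible_AE_lebesgue_on[OF N(1) \<Omega>])
    fix x assume x: "x \<in> \<Omega>" "x \<notin> N"
    obtain u v where uv: "x \<in> box u v" "box u v \<subseteq> \<Omega>"
      using \<Omega> x(1) by (meson open_contains_ball rational_boxes order_trans)
    have "\<forall>\<^sub>F h in at_right 0. x + h *\<^sub>R One \<in> box u v"
    proof (rule topological_tendstoD)
      show "((\<lambda>h. x + h *\<^sub>R One) \<longlongrightarrow> x) (at_right 0)"
        by (auto intro!: tendsto_eq_intros)
    qed (use uv in auto)
    then have "\<forall>\<^sub>F h in at_right 0.
        integral (cbox x (x + h *\<^sub>R One)) (zero_ext \<Omega> f) /\<^sub>R h ^ DIM(real^'n) = 0"
    proof eventually_elim
      case (elim h)
      have "cbox x (x + h *\<^sub>R One) \<subseteq> box u v"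
        using elim uv(1) by (auto simp: mem_box_cart) (meson order.strict_trans1 order.strict_trans2)+
      then show ?case using box_zero[of x "x + h *\<^sub>R One"] uv(2) by simp
    qed
    then show "f x = 0"
      by (rule tendsto_unique[OF trivial_limit_at_right_real N(2)[OF x] tendsto_eventually])
  qed
qed

lemma subset_cbox_cart:
  fixes a b c d :: "real^'n::finite"
  assumes "\<And>j. c $ j \<le> a $ j" "\<And>j. b $ j \<le> d $ j"
  shows "cbox a b \<subseteq> cbox c d"
  unfolding mem_box_cart subset_iff using assms by (meson order_trans)

text \<open>
  The difference of a product of bumps and its translate along coordinate \<open>i\<close> is the \<open>i\<close>-th partial derivative
  of a test function, because its factor in coordinate \<open>i\<close> has integral zero and therefore a compactly
  supported antiderivative. The support of this antiderivative is the interval swept by the translation,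
  which is why the swept box has to lie in \<open>\<Omega>\<close>.
\<close>

lemma box_integral_shift:
  fixes \<Omega> :: "(real^'n::finite) set"
  assumes \<Omega>: "open \<Omega>" and f: "integrable (lebesgue_on \<Omega>) f"
    and zero: "\<And>\<phi>. \<phi> \<in> test_functions \<Omega> \<Longrightarrow> (LINT x|lebesgue_on \<Omega>. f x * partial_deriv i \<phi> x) = 0"
    and c: "0 \<le> c" and sub: "cbox a (b + c *\<^sub>R axis i 1) \<subseteq> \<Omega>"
  shows "integral (cbox (a + c *\<^sub>R axis i 1) (b + c *\<^sub>R axis i 1)) (zero_ext \<Omega> f)
       = integral (cbox a b) (zero_ext \<Omega> f)"
proof -
  define e where "e = c *\<^sub>R (axis i 1 :: real^'n)"
  have e: "e $ j = (if j = i then c else 0)" for j by (simp add: e_def axis_def)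
  define \<beta> where "\<beta> a b m x = (\<Prod>j\<in>UNIV. bump m (a $ j) (b $ j) (x $ j))" for a b x :: "real^'n" and m
  have lim: "(\<lambda>m. LINT x|lebesgue_on \<Omega>. f x * \<beta> a b m x) \<longlonglongrightarrow> integral (cbox a b) (zero_ext \<Omega> f)"
    if "cbox a b \<subseteq> \<Omega>" for a b
    unfolding \<beta>_def by (rule bump_integral_tendsto_box_integral[OF \<Omega> f that])
  have "(LINT x|lebesgue_on \<Omega>. f x * \<beta> (a + e) (b + e) m x) = (LINT x|lebesgue_on \<Omega>. f x * \<beta> a b m x)" for m
  proof -
    define g where "g = bump m (a $ i) (b $ i)"
    have "\<exists>F. \<forall>t. (F has_real_derivative g t) (at t)"
      using einterval_antiderivative[of "-\<infinity>" "\<infinity>" g] smooth_continuous[OF smooth_bump, of UNIV]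
      by (auto simp: g_def continuous_on_eq_continuous_at has_real_derivative_iff_has_vector_derivative)
    then obtain F where F: "(F has_real_derivative g t) (at t)" for t by blast
    have "smooth F" using smooth_antiderivative[OF _ F] smooth_bump by (simp add: g_def)
    define \<Phi> where "\<Phi> t = F (t - c) - F t" for t
    have "smooth (\<lambda>t. F (1 * t + - c) - F t)"
      by (intro smooth_diff smooth_affine \<open>smooth F\<close>)
    then have "smooth \<Phi>" by (simp add: \<Phi>_def[abs_def])
    have "((\<lambda>t. F (t - c)) has_real_derivative g (t - c)) (at t)" for t
    proof -
      have "((\<lambda>t. t - c) has_real_derivative 1) (at t)" by (auto intro!: derivative_eq_intros)
      from DERIV_chain2[OF F this] show ?thesis by simp
    qed
    then have "(\<Phi> has_real_derivative g (t - c) - g t) (at t)" for t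
      unfolding \<Phi>_def by (intro DERIV_diff F)
    then have deriv\<Phi>: "deriv \<Phi> t = g (t - c) - g t" for t by (simp add: DERIV_imp_deriv)
    \<comment> \<open>By the mean value theorem, \<open>\<Phi> t\<close> is \<open>c\<close> times a value of \<open>g\<close> between \<open>t - c\<close> and \<open>t\<close>.\<close>
    have supp: "a $ i \<le> t \<and> t \<le> b $ i + c" if "\<Phi> t \<noteq> 0" for t
    proof (rule ccontr)
      assume out: "\<not> ?thesis"
      have "c \<noteq> 0" using that by (auto simp: \<Phi>_def)
      then have "t - c < t" using c by simp
      then obtain z where "t - c < z" "z < t" "F t - F (t - c) = (t - (t - c)) * g z"
        using MVT2[of "t - c" t F g] F by blast
      moreover have "g z = 0"
        unfolding g_def using out calculation by (intro bump_eq_0) auto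
      ultimately show False using that by (simp add: \<Phi>_def)
    qed
    define p where "p = (\<lambda>j. bump m (a $ j) (b $ j))(i := \<Phi>)"
    have p: "smooth (p j)" for j by (simp add: p_def smooth_bump \<open>smooth \<Phi>\<close>)
    have "(\<lambda>y :: real^'n. \<Prod>j\<in>UNIV. p j (y $ j)) \<in> test_functions \<Omega>"
    proof (rule prod_test_function[OF p _ sub])
      fix j t assume "p j t \<noteq> 0"
      then show "a $ j \<le> t \<and> t \<le> (b + c *\<^sub>R axis i 1) $ j"
        using supp[of t] bump_eq_0[of t "a $ j" "b $ j" m] linear[of t "a $ j"] linear[of t "b $ j"]
        by (auto simp: p_def axis_def split: if_splits)
    qed
    moreover have "partial_deriv i (\<lambda>y :: real^'n. \<Prod>j\<in>UNIV. p j (y $ j)) y = \<beta> (a + e) (b + e) m y - \<beta> a b m y" for y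
    proof -
      let ?r = "\<Prod>j\<in>UNIV - {i}. bump m (a $ j) (b $ j) (y $ j)"
      have "partial_deriv i (\<lambda>y :: real^'n. \<Prod>j\<in>UNIV. p j (y $ j)) y = (g (y $ i - c) - g (y $ i)) * ?r"
        unfolding partial_deriv_prod[OF p]
        by (subst prod.remove[of UNIV i]) (auto simp: p_def deriv\<Phi> intro!: prod.cong)
      moreover have "\<beta> a b m y = g (y $ i) * ?r"
        unfolding \<beta>_def by (subst prod.remove[of UNIV i]) (auto simp: g_def)
      moreover have "\<beta> (a + e) (b + e) m y = g (y $ i - c) * ?r"
        unfolding \<beta>_def by (subst prod.remove[of UNIV i]) (auto simp: g_def e bump_def algebra_simps intro!: prod.cong)
      ultimately show ?thesis by (simp add: algebra_simps)
    qed
    ultimately have "(LINT x|lebesgue_on \<Omega>. f x * (\<beta> (a + e) (b + e) m x - \<beta> a b m x)) = 0"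
      using zero by fastforce
    moreover have int: "integrable (lebesgue_on \<Omega>) (\<lambda>x. f x * \<beta> a b m x)" for a b
    proof (rule Bochner_Integration.integrable_bound[OF f])
      have "continuous_on UNIV (\<beta> a b m)"
        using C_k_prod[of "\<lambda>j. bump m (a $ j) (b $ j)" 0] smooth_bump by (simp add: \<beta>_def[abs_def])
      then have "\<beta> a b m \<in> borel_measurable (lebesgue_on \<Omega>)"
        using \<Omega> by (intro continuous_imp_measurable_on_sets_lebesgue) (auto intro: continuous_on_subset)
      then show "(\<lambda>x. f x * \<beta> a b m x) \<in> borel_measurable (lebesgue_on \<Omega>)"
        using f by auto
      have "0 \<le> \<beta> a b m x" "\<beta> a b m x \<le> 1" for x
        by (auto simp: \<beta>_def intro!: prod_nonneg prod_le_1 bump_bounds)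
      then show "AE x in lebesgue_on \<Omega>. norm (f x * \<beta> a b m x) \<le> norm (f x)"
        by (intro AE_I2) (simp add: abs_mult mult_left_le)
    qed
    ultimately show ?thesis
      using Bochner_Integration.integral_diff[OF int[of "a + e" "b + e"] int[of a b]]
      by (simp only: right_diff_distrib)
  qed
  moreover have "cbox (a + e) (b + e) \<subseteq> cbox a (b + e)"
    by (rule subset_cbox_cart) (use c in \<open>auto simp: e\<close>)
  then have "(\<lambda>m. LINT x|lebesgue_on \<Omega>. f x * \<beta> (a + e) (b + e) m x)
      \<longlonglongrightarrow> integral (cbox (a + e) (b + e)) (zero_ext \<Omega> f)"
    using sub unfolding e_def by (intro lim) blast
  ultimately have "(\<lambda>m. LINT x|lebesgue_on \<Omega>. f x * \<beta> a b m x)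
      \<longlonglongrightarrow> integral (cbox (a + e) (b + e)) (zero_ext \<Omega> f)"
    by (simp only:)
  moreover have "cbox a b \<subseteq> cbox a (b + e)"
    by (rule subset_cbox_cart) (use c in \<open>auto simp: e\<close>)
  ultimately show ?thesis
    using lim[of a b] LIMSEQ_unique sub unfolding e_def by blast
qed

text \<open>
  A general translation is a sequence of translations along the coordinates; a box contains with any two points
  all the mixed points that occur on the way, so the sequence never leaves \<open>\<Omega>\<close>.
\<close>

lemma box_integral_translate:
  fixes \<Omega> :: "(real^'n::finite) set"
  assumes \<Omega>: "open \<Omega>" and f: "integrable (lebesgue_on \<Omega>) f"
    and zero: "\<And>i \<phi>. \<phi> \<in> test_functions \<Omega> \<Longrightarrow> (LINT x|lebesgue_on \<Omega>. f x * partial_deriv i \<phi> x) = 0"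
    and uv: "box u v \<subseteq> \<Omega>"
    and h: "0 \<le> h" and x: "x \<in> box u v" "x + h *\<^sub>R One \<in> box u v"
    and y: "y \<in> box u v" "y + h *\<^sub>R One \<in> box u v"
  shows "integral (cbox x (x + h *\<^sub>R One)) (zero_ext \<Omega> f) = integral (cbox y (y + h *\<^sub>R One)) (zero_ext \<Omega> f)"
proof -
  \<comment> \<open>\<open>z S\<close> has already moved to \<open>y\<close> in the coordinates of \<open>S\<close>.\<close>
  define z where "z S = (\<chi> j. if j \<in> S then y $ j else x $ j)" for S
  define I where "I w = integral (cbox w (w + h *\<^sub>R One)) (zero_ext \<Omega> f)" for w
  have shift: "I (w + c *\<^sub>R axis i 1) = I w"
    if "0 \<le> c" "w \<in> box u v" "w + c *\<^sub>R axis i 1 + h *\<^sub>R One \<in> box u v" for w c i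
  proof -
    have "cbox w (w + h *\<^sub>R One + c *\<^sub>R axis i 1) \<subseteq> box u v"
      using that(2,3) by (auto simp: mem_box_cart add_ac) (meson order.strict_trans1 order.strict_trans2)+
    then have "cbox w (w + h *\<^sub>R One + c *\<^sub>R axis i 1) \<subseteq> \<Omega>" using uv by blast
    from box_integral_shift[OF \<Omega> f zero that(1) this]
    show ?thesis by (simp add: I_def add_ac)
  qed
  have in_box: "z S \<in> box u v" "z S + h *\<^sub>R One \<in> box u v" for S
    using x y by (auto simp: z_def mem_box_cart)
  have "I (z S) = I x" for S
    using finite[of S]
  proof (induction S rule: finite_induct)
    case empty
    then show ?case by (simp add: z_def)
  next
    case (insert i S)
    have step: "z (insert i S) = z S + (y $ i - x $ i) *\<^sub>R axis i 1"
      using insert(2) by (auto simp: z_def vec_eq_iff axis_def)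
    have "I (z (insert i S)) = I (z S)"
    proof (cases "x $ i \<le> y $ i")
      case True
      then show ?thesis
        using shift[of "y $ i - x $ i" "z S" i] in_box(1)[of S] in_box(2)[of "insert i S"] step by simp
    next
      case False
      have "z S = z (insert i S) + (x $ i - y $ i) *\<^sub>R axis i 1"
        unfolding step by (simp add: algebra_simps)
      then show ?thesis
        using False shift[of "x $ i - y $ i" "z (insert i S)" i] in_box(1)[of "insert i S"] in_box(2)[of S] by simp
    qed
    then show ?case using insert.IH by simp
  qed
  from this[of UNIV] show ?thesis by (simp add: z_def I_def)
qed

text \<open>
  Averages over small cubes in a box contained in \<open>\<Omega>\<close> agree, so \<open>f\<close> takes the same value at all its Lebesgue
  points there. Connectedness then propagates this value through \<open>\<Omega>\<close>.
\<close>

lemma weak_gradient_zero_imp_constant: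
  fixes \<Omega> :: "(real^'n::finite) set"
  assumes \<Omega>: "open \<Omega>" "connected \<Omega>" and f: "integrable (lebesgue_on \<Omega>) f"
    and zero: "\<And>i \<phi>. \<phi> \<in> test_functions \<Omega> \<Longrightarrow> (LINT x|lebesgue_on \<Omega>. f x * partial_deriv i \<phi> x) = 0"
  shows "\<exists>c. AE x in lebesgue_on \<Omega>. f x = c"
proof -
  obtain N where N: "negligible N" "\<And>x. x \<in> \<Omega> \<Longrightarrow> x \<notin> N \<Longrightarrow>
       ((\<lambda>h. integral (cbox x (x + h *\<^sub>R One)) (zero_ext \<Omega> f) /\<^sub>R h ^ DIM(real^'n)) \<longlongrightarrow> f x) (at_right 0)"
    using lebesgue_points[OF \<Omega>(1) f] by blast
  have same: "f x = f y"
    if uv: "box u v \<subseteq> \<Omega>" and x: "x \<in> box u v" "x \<notin> N" and y: "y \<in> box u v" "y \<notin> N" for u v x y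
  proof -
    have "\<forall>\<^sub>F h in at_right 0. w + h *\<^sub>R One \<in> box u v" if "w \<in> box u v" for w
    proof (rule topological_tendstoD)
      show "((\<lambda>h. w + h *\<^sub>R One) \<longlongrightarrow> w) (at_right 0)"
        by (auto intro!: tendsto_eq_intros)
    qed (use that in auto)
    from this[OF x(1)] this[OF y(1)] eventually_at_right_less[of 0]
    have "\<forall>\<^sub>F h in at_right 0.
      integral (cbox x (x + h *\<^sub>R One)) (zero_ext \<Omega> f) /\<^sub>R h ^ DIM(real^'n) =
      integral (cbox y (y + h *\<^sub>R One)) (zero_ext \<Omega> f) /\<^sub>R h ^ DIM(real^'n)"
      by eventually_elim
         (use box_integral_translate[OF \<Omega>(1) f zero uv _ x(1) _ y(1)] in \<open>simp add: less_imp_le\<close>)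
    moreover have "x \<in> \<Omega>" "y \<in> \<Omega>" using uv x y by auto
    ultimately show "f x = f y"
      using tendsto_unique[OF trivial_limit_at_right_real Lim_transform_eventually[OF N(2)[of x]] N(2)[of y]] x y
      by blast
  qed
  show ?thesis
  proof (cases "\<Omega> \<subseteq> N")
    case True
    then show ?thesis
      using negligible_AE_lebesgue_on[OF N(1) \<Omega>(1), of "\<lambda>x. f x = 0"] by blast
  next
    case False
    then obtain a where a: "a \<in> \<Omega>" "a \<notin> N" by blast
    have "f b = f a" if b: "b \<in> \<Omega>" "b \<notin> N" for b
    proof (rule connected_induction[OF \<Omega>(2), where P = "\<lambda>x. x \<notin> N" and Q = "\<lambda>x. f x = f a" and a = a and b = b])
      show "\<exists>z. z \<in> T \<and> z \<notin> N" if T: "openin (top_of_set \<Omega>) T" "x \<in> T" for T x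
      proof -
        have "open T" using T(1) \<Omega>(1) openin_open_eq by blast
        then have "\<not> negligible T" using T(2) open_not_negligible by blast
        then show ?thesis using N(1) negligible_subset by blast
      qed
      show "\<exists>T. openin (top_of_set \<Omega>) T \<and> x \<in> T \<and>
          (\<forall>y\<in>T. \<forall>z\<in>T. y \<notin> N \<and> z \<notin> N \<and> f y = f a \<longrightarrow> f z = f a)" if x: "x \<in> \<Omega>" for x
      proof -
        obtain u v where uv: "x \<in> box u v" "box u v \<subseteq> \<Omega>"
          using \<Omega>(1) x by (meson open_contains_ball rational_boxes order_trans)
        have "openin (top_of_set \<Omega>) (box u v)"
          using uv(2) open_box by (simp add: open_openin_trans openin_open_eq[OF \<Omega>(1)])
        moreover have "f z = f a" if "y \<in> box u v" "z \<in> box u v" "y \<notin> N" "z \<notin> N" "f y = f a" for y z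
          using same[OF uv(2), of y z] that by simp
        ultimately show ?thesis using uv(1) by blast
      qed
    qed (use a b in auto)
    then show ?thesis
      using negligible_AE_lebesgue_on[OF N(1) \<Omega>(1), of "\<lambda>x. f x = f a"] by blast
  qed
qed

section \<open>Antiderivatives along a coordinate direction\<close>

lemma test_function_facts:
  fixes \<Omega> :: "(real^'n::finite) set"
  assumes "\<phi> \<in> test_functions \<Omega>"
  shows test_function_continuous: "continuous_on UNIV \<phi>"
    and test_function_partial_continuous: "continuous_on UNIV (partial_deriv i \<phi>)"
    and test_function_outside: "x \<notin> \<Omega> \<Longrightarrow> \<phi> x = 0"
    and test_function_partial_outside: "x \<notin> \<Omega> \<Longrightarrow> partial_deriv i \<phi> x = 0"
    and test_function_bounded: "\<exists>C. \<forall>x. \<bar>\<phi> x\<bar> \<le> C"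
    and test_function_partial_bounded: "\<exists>C. \<forall>x. \<bar>partial_deriv i \<phi> x\<bar> \<le> C"
    and test_function_line_deriv:
      "((\<lambda>s. \<phi> (x + s *\<^sub>R axis i 1)) has_real_derivative partial_deriv i \<phi> (x + s *\<^sub>R axis i 1)) (at s)"
proof -
  define K where "K = closure {x. \<phi> x \<noteq> 0}"
  have K: "compact K" "K \<subseteq> \<Omega>" and Ck: "C_k k \<phi>" for k
    using assms by (auto simp: test_functions_def K_def)
  have diff: "\<phi> differentiable (at x)" for x
    using Ck[of 1] by (simp add: differentiable_on_def)
  have contp: "continuous_on UNIV (partial_deriv i \<phi>)" for i
    using Ck[of 1] by simp
  have out: "\<phi> x = 0" if "x \<notin> K" for x
    using that closure_subset[of "{x. \<phi> x \<noteq> 0}"] by (auto simp: K_def)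
  have outp: "partial_deriv i \<phi> x = 0" if "x \<notin> K" for i x
  proof -
    have "open (- K)" using K(1) by (simp add: compact_imp_closed open_Compl)
    then have "(\<phi> has_derivative (\<lambda>_. 0)) (at x)"
      by (rule has_derivative_transform_within_open[OF has_derivative_const[of 0]])
         (use that in \<open>simp_all add: out\<close>)
    then show ?thesis
      by (simp add: partial_deriv_def frechet_derivative_at[symmetric])
  qed
  have bdd: "\<exists>C. \<forall>x. \<bar>g x\<bar> \<le> C" if "continuous_on UNIV g" "\<And>x. x \<notin> K \<Longrightarrow> g x = 0" for g :: "real^'n \<Rightarrow> real"
  proof -
    have "bounded (g ` K)"
      using K(1) that(1) by (intro compact_imp_bounded compact_continuous_image)
        (auto intro: continuous_on_subset)
    then obtain C where C: "\<forall>x\<in>K. \<bar>g x\<bar> \<le> C" by (auto simp: bounded_iff)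
    then have "\<forall>x. \<bar>g x\<bar> \<le> max C 0" using that(2) by (metis abs_zero le_max_iff_disj order_refl)
    then show ?thesis by blast
  qed
  show cont: "continuous_on UNIV \<phi>" using Ck[of 0] by simp
  show "continuous_on UNIV (partial_deriv i \<phi>)" by (rule contp)
  show "x \<notin> \<Omega> \<Longrightarrow> \<phi> x = 0" "x \<notin> \<Omega> \<Longrightarrow> partial_deriv i \<phi> x = 0"
    using K(2) out outp by auto
  show "\<exists>C. \<forall>x. \<bar>\<phi> x\<bar> \<le> C" by (rule bdd[OF cont out])
  show "\<exists>C. \<forall>x. \<bar>partial_deriv i \<phi> x\<bar> \<le> C" by (rule bdd[OF contp outp])
  show "((\<lambda>s. \<phi> (x + s *\<^sub>R axis i 1)) has_real_derivative partial_deriv i \<phi> (x + s *\<^sub>R axis i 1)) (at s)"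
  proof -
    let ?D = "frechet_derivative \<phi> (at (x + s *\<^sub>R axis i 1))"
    have D: "(\<phi> has_derivative ?D) (at (x + s *\<^sub>R axis i 1))"
      using diff frechet_derivative_works by blast
    have "((\<lambda>s. x + s *\<^sub>R axis i 1) has_derivative (\<lambda>h. h *\<^sub>R axis i 1)) (at s)"
      by (auto intro!: derivative_eq_intros)
    from has_derivative_compose[OF this D]
    have "((\<lambda>s. \<phi> (x + s *\<^sub>R axis i 1)) has_derivative (\<lambda>h. ?D (h *\<^sub>R axis i 1))) (at s)" .
    moreover have "(\<lambda>h. ?D (h *\<^sub>R axis i 1)) = (*) (?D (axis i 1))"
      using has_derivative_bounded_linear[OF D] by (auto simp: linear_simps mult.commute)
    ultimately show ?thesis by (simp add: has_field_derivative_def partial_deriv_def)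
  qed
qed

lemma lborel_integral_shift:
  fixes f :: "'a::euclidean_space \<Rightarrow> real"
  assumes [measurable]: "f \<in> borel_measurable borel"
  shows "(LINT x|lborel. f (x + c)) = (LINT x|lborel. f x)"
  using integral_distr[of "(+) c" lborel borel f] by (simp add: lborel_distr_plus add.commute)

lemma lborel_integrable_shift:
  fixes f :: "'a::euclidean_space \<Rightarrow> real"
  assumes "integrable lborel f"
  shows "integrable lborel (\<lambda>x. f (x + c))"
proof -
  have "integrable (distr lborel borel ((+) c)) f" using assms by (simp add: lborel_distr_plus)
  from integrable_distr[OF _ this] show ?thesis by (simp add: add.commute)
qed

text \<open>
  The joint integrability that justifies all exchanges of integration below. Using translation invariance
  on the whole space avoids splitting the space into the line along \<open>e\<close> and its complement.
\<close>

lemma sheared_integrable: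
  fixes g :: "'a::euclidean_space \<Rightarrow> real"
  assumes g: "integrable lborel g" and M: "0 \<le> M"
  shows "integrable (lborel \<Otimes>\<^sub>M lborel) (\<lambda>(s :: real, x). indicator {0..M} s * g (x + s *\<^sub>R e))"
proof (rule lborel_pair.Fubini_integrable)
  have [measurable]: "g \<in> borel_measurable borel" using g by auto
  show "(\<lambda>(s :: real, x). indicator {0..M} s * g (x + s *\<^sub>R e)) \<in> borel_measurable (lborel \<Otimes>\<^sub>M lborel)"
    by measurable
  have "(LINT x|lborel. norm (indicator {0..M} s * g (x + s *\<^sub>R e))) = indicator {0..M} s * (LINT x|lborel. \<bar>g x\<bar>)" for s :: real
    using lborel_integral_shift[of "\<lambda>x. \<bar>g x\<bar>" "s *\<^sub>R e"] by (simp add: abs_mult)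
  then show "integrable lborel (\<lambda>s :: real. LINT x|lborel. norm (case (s, x) of (s, x) \<Rightarrow> indicator {0..M} s * g (x + s *\<^sub>R e)))"
    using M by simp
  show "AE s :: real in lborel. integrable lborel (\<lambda>x. case (s, x) of (s, x) \<Rightarrow> indicator {0..M} s * g (x + s *\<^sub>R e))"
    using lborel_integrable_shift[OF g] by simp
qed

text \<open>
  With \<open>M\<close> beyond the diameter of the support of \<open>g\<close>, the direction \<open>- e\<close> gives the antiderivative of \<open>g\<close> along \<open>e\<close>
  on that support, starting from zero outside of it.
\<close>

definition ray_integral :: "real \<Rightarrow> 'a::euclidean_space \<Rightarrow> ('a \<Rightarrow> real) \<Rightarrow> 'a \<Rightarrow> real" where
  "ray_integral M e g x = (LINT s|lborel. indicator {0..M} s * g (x + s *\<^sub>R e))"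

lemma
  fixes g :: "'a::euclidean_space \<Rightarrow> real"
  assumes g: "integrable lborel g" and M: "0 \<le> M"
  shows ray_integrable: "AE x in lborel. integrable lborel (\<lambda>s. indicator {0..M} s * g (x + s *\<^sub>R e))"
    and integrable_ray_integral: "integrable lborel (ray_integral M e g)"
    and integral_ray_integral: "(LINT x|lborel. ray_integral M e g x) = M * (LINT x|lborel. g x)"
proof -
  have [measurable]: "g \<in> borel_measurable borel" using g by auto
  note int = sheared_integrable[OF g M, of e]
  show "AE x in lborel. integrable lborel (\<lambda>s. indicator {0..M} s * g (x + s *\<^sub>R e))"
    by (rule lborel_pair.AE_integrable_snd[OF int])
  show "integrable lborel (ray_integral M e g)"
    unfolding ray_integral_def[abs_def] by (rule lborel_pair.integrable_snd[OF int])
  have "(LINT x|lborel. ray_integral M e g x) =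
        (LINT s|lborel. LINT x|lborel. indicator {0..M} s * g (x + s *\<^sub>R e))"
    unfolding ray_integral_def by (rule lborel_pair.Fubini_integral[OF int])
  also have "\<dots> = (LINT s|lborel. indicator {0..M} s * (LINT x|lborel. g x))"
    using lborel_integral_shift[of g] by simp
  also have "\<dots> = M * (LINT x|lborel. g x)"
    using M by simp
  finally show "(LINT x|lborel. ray_integral M e g x) = M * (LINT x|lborel. g x)" .
qed

text \<open>
  Cauchy-Schwarz on \<open>{0..M}\<close>, obtained by expanding the variance of \<open>g\<close> along the ray around its mean.
\<close>

lemma ray_integral_square_le:
  assumes int: "integrable lborel (\<lambda>s. indicator {0..M} s * g (x + s *\<^sub>R e))"
    and int2: "integrable lborel (\<lambda>s. indicator {0..M} s * (g (x + s *\<^sub>R e))\<^sup>2)" and M: "0 < M"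
  shows "(ray_integral M e g x)\<^sup>2 \<le> M * ray_integral M e (\<lambda>y. (g y)\<^sup>2) x"
proof -
  define c where "c = ray_integral M e g x / M"
  have "0 \<le> (LINT s|lborel. indicator {0..M} s * (g (x + s *\<^sub>R e) - c)\<^sup>2)"
    by (intro integral_nonneg_AE) auto
  also have "\<dots> = (LINT s|lborel. indicator {0..M} s * (g (x + s *\<^sub>R e))\<^sup>2
      - 2 * c * (indicator {0..M} s * g (x + s *\<^sub>R e)) + c\<^sup>2 * indicator {0..M} s)"
    by (intro Bochner_Integration.integral_cong) (auto simp: power2_eq_square algebra_simps)
  also have "\<dots> = ray_integral M e (\<lambda>y. (g y)\<^sup>2) x - 2 * c * ray_integral M e g x + c\<^sup>2 * M"
    using int int2 M by (simp add: ray_integral_def)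
  also have "\<dots> = ray_integral M e (\<lambda>y. (g y)\<^sup>2) x - (ray_integral M e g x)\<^sup>2 / M"
    using M by (simp add: c_def power2_eq_square field_simps)
  finally show ?thesis using M by (simp add: field_simps)
qed

lemma ray_integral_L2:
  fixes g :: "'a::euclidean_space \<Rightarrow> real"
  assumes g: "integrable lborel g" and g2: "integrable lborel (\<lambda>x. (g x)\<^sup>2)" and M: "0 < M"
  shows "integrable lborel (\<lambda>x. (ray_integral M e g x)\<^sup>2)"
    and "(LINT x|lborel. (ray_integral M e g x)\<^sup>2) \<le> M\<^sup>2 * (LINT x|lborel. (g x)\<^sup>2)"
proof -
  have le: "AE x in lborel. (ray_integral M e g x)\<^sup>2 \<le> M * ray_integral M e (\<lambda>y. (g y)\<^sup>2) x"
    using ray_integrable[OF g less_imp_le[OF M]] ray_integrable[OF g2 less_imp_le[OF M]]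
    by eventually_elim (rule ray_integral_square_le[OF _ _ M])
  have [measurable]: "ray_integral M e g \<in> borel_measurable borel"
    using integrable_ray_integral[OF g, of M e] M by auto
  have int: "integrable lborel (\<lambda>x. M * ray_integral M e (\<lambda>y. (g y)\<^sup>2) x)"
    using integrable_ray_integral[OF g2, of M e] M by simp
  show int2: "integrable lborel (\<lambda>x. (ray_integral M e g x)\<^sup>2)"
    by (rule Bochner_Integration.integrable_bound[OF int]) (use le in \<open>auto elim: eventually_mono\<close>)
  have "(LINT x|lborel. (ray_integral M e g x)\<^sup>2) \<le> (LINT x|lborel. M * ray_integral M e (\<lambda>y. (g y)\<^sup>2) x)"
    by (rule integral_mono_AE[OF int2 int le])
  also have "\<dots> = M\<^sup>2 * (LINT x|lborel. (g x)\<^sup>2)"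
    using integral_ray_integral[OF g2, of M e] M by (simp add: power2_eq_square)
  finally show "(LINT x|lborel. (ray_integral M e g x)\<^sup>2) \<le> M\<^sup>2 * (LINT x|lborel. (g x)\<^sup>2)" .
qed

lemma integrable_mult_bounded:
  fixes f g :: "'a \<Rightarrow> real"
  assumes "integrable M f" "g \<in> borel_measurable M" "\<And>x. \<bar>g x\<bar> \<le> C"
  shows "integrable M (\<lambda>x. f x * g x)"
proof (rule Bochner_Integration.integrable_bound)
  show "integrable M (\<lambda>x. C * f x)" using assms by simp
  show "(\<lambda>x. f x * g x) \<in> borel_measurable M" using assms by auto
  show "AE x in M. norm (f x * g x) \<le> norm (C * f x)"
  proof (rule AE_I2)
    fix x
    have "\<bar>g x\<bar> * \<bar>f x\<bar> \<le> C * \<bar>f x\<bar>" by (intro mult_right_mono assms) auto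
    moreover have "0 \<le> C" using assms(3)[of x] by linarith
    ultimately show "norm (f x * g x) \<le> norm (C * f x)" by (simp add: abs_mult mult.commute)
  qed
qed

text \<open>
  Exchanging the integrations and translating by \<open>s *\<^sub>R e\<close> moves the ray integral to the other factor and
  reverses its direction.
\<close>

lemma ray_integral_duality:
  fixes g \<psi> :: "'a::euclidean_space \<Rightarrow> real"
  assumes g: "integrable lborel g" and \<psi>[measurable]: "\<psi> \<in> borel_measurable borel"
    and C: "\<And>x. \<bar>\<psi> x\<bar> \<le> C" and M: "0 \<le> M"
  shows "(LINT x|lborel. ray_integral M (- e) g x * \<psi> x) = (LINT x|lborel. g x * ray_integral M e \<psi> x)"
proof -
  have [measurable]: "g \<in> borel_measurable borel" using g by auto
  have "integrable (lborel \<Otimes>\<^sub>M lborel)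
      (\<lambda>p. (case p of (s :: real, x) \<Rightarrow> indicator {0..M} s * g (x + s *\<^sub>R - e)) * \<psi> (snd p))"
    using C by (intro integrable_mult_bounded[OF sheared_integrable[OF g M]]) auto
  then have int1: "integrable (lborel \<Otimes>\<^sub>M lborel) (\<lambda>(s :: real, x). indicator {0..M} s * g (x - s *\<^sub>R e) * \<psi> x)"
    by (simp add: case_prod_beta')
  have "integrable (lborel \<Otimes>\<^sub>M lborel)
      (\<lambda>p. (case p of (s :: real, x) \<Rightarrow> indicator {0..M} s * g (x + s *\<^sub>R 0)) * \<psi> (snd p + fst p *\<^sub>R e))"
    using C by (intro integrable_mult_bounded[OF sheared_integrable[OF g M]]) auto
  then have int2: "integrable (lborel \<Otimes>\<^sub>M lborel) (\<lambda>(s :: real, x). indicator {0..M} s * g x * \<psi> (x + s *\<^sub>R e))"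
    by (simp add: case_prod_beta')
  have "(LINT x|lborel. ray_integral M (- e) g x * \<psi> x) =
        (LINT x|lborel. LINT s|lborel. indicator {0..M} s * g (x - s *\<^sub>R e) * \<psi> x)"
    by (simp add: ray_integral_def)
  also have "\<dots> = (LINT s|lborel. LINT x|lborel. indicator {0..M} s * g (x - s *\<^sub>R e) * \<psi> x)"
    by (rule lborel_pair.Fubini_integral[OF int1])
  also have "\<dots> = (LINT s|lborel. LINT x|lborel. indicator {0..M} s * g x * \<psi> (x + s *\<^sub>R e))"
  proof (rule Bochner_Integration.integral_cong[OF refl])
    fix s :: real
    show "(LINT x|lborel. indicator {0..M} s * g (x - s *\<^sub>R e) * \<psi> x) =
          (LINT x|lborel. indicator {0..M} s * g x * \<psi> (x + s *\<^sub>R e))"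
      using lborel_integral_shift[of "\<lambda>x. indicator {0..M} s * g (x - s *\<^sub>R e) * \<psi> x" "s *\<^sub>R e"] by simp
  qed
  also have "\<dots> = (LINT x|lborel. LINT s|lborel. indicator {0..M} s * g x * \<psi> (x + s *\<^sub>R e))"
    by (rule lborel_pair.Fubini_integral[OF int2, symmetric])
  also have "\<dots> = (LINT x|lborel. g x * ray_integral M e \<psi> x)"
    by (simp add: ray_integral_def mult.assoc mult.left_commute)
  finally show ?thesis .
qed

lemma ray_integral_partial_deriv:
  assumes \<phi>: "\<phi> \<in> test_functions \<Omega>" and M: "0 \<le> M"
  shows "ray_integral M (axis i 1) (partial_deriv i \<phi>) x = \<phi> (x + M *\<^sub>R axis i 1) - \<phi> x"
proof -
  have "(LINT s|lborel. partial_deriv i \<phi> (x + s *\<^sub>R axis i 1) * indicator {0..M} s)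
      = \<phi> (x + M *\<^sub>R axis i 1) - \<phi> (x + 0 *\<^sub>R axis i 1)"
  proof (rule integral_FTC_Icc_real[OF M])
    have "continuous_on UNIV (\<lambda>s. partial_deriv i \<phi> (x + s *\<^sub>R axis i 1))"
      by (rule continuous_on_compose2[OF test_function_partial_continuous[OF \<phi>]])
         (auto intro!: continuous_intros)
    then show "isCont (\<lambda>s. partial_deriv i \<phi> (x + s *\<^sub>R axis i 1)) s" for s
      by (simp add: continuous_on_eq_continuous_at)
  qed (rule test_function_line_deriv[OF \<phi>])
  then show ?thesis by (simp add: ray_integral_def mult.commute)
qed

lemma LINT_lebesgue_on_borel:
  fixes f :: "'a::euclidean_space \<Rightarrow> real"
  assumes [measurable]: "\<Omega> \<in> sets borel" "f \<in> borel_measurable borel"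
  shows "(LINT x|lebesgue_on \<Omega>. f x) = (LINT x|lborel. indicator \<Omega> x * f x)"
    and "integrable (lebesgue_on \<Omega>) f \<longleftrightarrow> integrable lborel (\<lambda>x. indicator \<Omega> x * f x)"
proof -
  have m: "(\<lambda>x. indicator \<Omega> x * f x) \<in> borel_measurable lborel" by measurable
  show "(LINT x|lebesgue_on \<Omega>. f x) = (LINT x|lborel. indicator \<Omega> x * f x)"
    using integral_completion[OF m] by (subst integral_restrict_space) auto
  show "integrable (lebesgue_on \<Omega>) f \<longleftrightarrow> integrable lborel (\<lambda>x. indicator \<Omega> x * f x)"
    using integrable_completion[OF m] by (subst integrable_restrict_space) auto
qed

lemma partial_deriv_borel:
  "\<phi> \<in> test_functions \<Omega> \<Longrightarrow> partial_deriv i \<phi> \<in> borel_measurable borel"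
  by (intro borel_measurable_continuous_onI test_function_partial_continuous)

text \<open>
  The partial derivative has the same integral as its average over rays of length 1, and this average is the
  difference of \<open>\<phi>\<close> and a translate, by the fundamental theorem of calculus.
\<close>

lemma integral_partial_deriv_zero:
  fixes \<Omega> :: "(real^'n::finite) set"
  assumes \<Omega>: "open \<Omega>" "bounded \<Omega>" and \<phi>: "\<phi> \<in> test_functions \<Omega>"
  shows "(LINT x|lebesgue_on \<Omega>. partial_deriv i \<phi> x) = 0"
proof -
  have fin: "emeasure lborel \<Omega> < \<infinity>" using \<Omega>(2) by (rule emeasure_bounded_finite)
  have [measurable]: "\<Omega> \<in> sets borel" using \<Omega>(1) by simp
  note [measurable] = partial_deriv_borel[OF \<phi>]
  have [measurable]: "\<phi> \<in> borel_measurable borel"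
    by (intro borel_measurable_continuous_onI test_function_continuous[OF \<phi>])
  have ind: "integrable lborel (\<lambda>x. indicator \<Omega> x :: real)"
    using fin by simp
  have int\<phi>: "integrable lborel \<phi>"
  proof -
    obtain C where "\<forall>x. \<bar>\<phi> x\<bar> \<le> C" using test_function_bounded[OF \<phi>] by blast
    then have "integrable lborel (\<lambda>x. indicator \<Omega> x * \<phi> x)"
      by (intro integrable_mult_bounded[OF ind]) auto
    moreover have "indicator \<Omega> x * \<phi> x = \<phi> x" for x
      using test_function_outside[OF \<phi>] by (auto simp: indicator_def)
    ultimately show ?thesis by simp
  qed
  have out: "indicator \<Omega> x * partial_deriv i \<phi> x = partial_deriv i \<phi> x" for x
    using test_function_partial_outside[OF \<phi>] by (auto simp: indicator_def)
  have intp: "integrable lborel (partial_deriv i \<phi>)"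
  proof -
    obtain C where "\<forall>x. \<bar>partial_deriv i \<phi> x\<bar> \<le> C" using test_function_partial_bounded[OF \<phi>] by blast
    then have "integrable lborel (\<lambda>x. indicator \<Omega> x * partial_deriv i \<phi> x)"
      by (intro integrable_mult_bounded[OF ind]) auto
    then show ?thesis by (simp add: out)
  qed
  have "(LINT x|lebesgue_on \<Omega>. partial_deriv i \<phi> x) = (LINT x|lborel. partial_deriv i \<phi> x)"
    by (simp add: LINT_lebesgue_on_borel out)
  also have "\<dots> = (LINT x|lborel. ray_integral 1 (axis i 1) (partial_deriv i \<phi>) x)"
    using integral_ray_integral[OF intp, of 1] by simp
  also have "\<dots> = (LINT x|lborel. \<phi> (x + axis i 1)) - (LINT x|lborel. \<phi> x)"
    using lborel_integrable_shift[OF int\<phi>] int\<phi> by (simp add: ray_integral_partial_deriv[OF \<phi>])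
  also have "\<dots> = 0"
    by (simp add: lborel_integral_shift)
  finally show ?thesis .
qed

text \<open>
  Fubini needs \<open>f (x + s *\<^sub>R e)\<close> to be jointly measurable in \<open>(s, x)\<close> for the product sigma-algebra. This
  holds for Borel functions \<open>f\<close>, but not for all Lebesgue measurable ones.
\<close>

lemma lebesgue_on_borel_representative:
  fixes f :: "'a::euclidean_space \<Rightarrow> real"
  assumes \<Omega>: "open \<Omega>" and f: "f \<in> borel_measurable (lebesgue_on \<Omega>)"
  obtains w where "w \<in> borel_measurable borel" "\<And>x. x \<notin> \<Omega> \<Longrightarrow> w x = 0"
    "AE x in lebesgue_on \<Omega>. f x = w x"
proof -
  have "(\<lambda>x. indicator \<Omega> x *\<^sub>R f x) \<in> borel_measurable lebesgue"
    using f \<Omega> by (subst (asm) borel_measurable_restrict_space_iff) auto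
  then obtain w where w: "w \<in> borel_measurable lborel" "AE x in lborel. indicator \<Omega> x *\<^sub>R f x = w x"
    using completion_ex_borel_measurable_real by blast
  show thesis
  proof (rule that[of "\<lambda>x. indicator \<Omega> x * w x"])
    show "(\<lambda>x. indicator \<Omega> x * w x) \<in> borel_measurable borel"
      using w(1) \<Omega> by auto
    have "AE x in lebesgue. indicator \<Omega> x *\<^sub>R f x = w x"
      using w(2) by (rule AE_completion)
    then have "AE x in lebesgue. x \<in> \<Omega> \<longrightarrow> f x = indicator \<Omega> x * w x"
      by eventually_elim (auto simp: indicator_def)
    then show "AE x in lebesgue_on \<Omega>. f x = indicator \<Omega> x * w x"
      using \<Omega> by (subst AE_restrict_space_iff) auto
  qed auto
qed

text \<open>
  Extend \<open>f\<close> by zero and integrate it backwards along the \<open>i\<close>-th axis. By duality the pairing with a partial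
  derivative of \<open>\<phi>\<close> becomes the pairing of \<open>f\<close> with \<open>\<phi> (x + M *\<^sub>R axis i 1) - \<phi> x\<close>, whose first
  term vanishes since \<open>M\<close> translates \<open>\<Omega>\<close> off itself.
\<close>

lemma directional_antiderivative:
  fixes \<Omega> :: "(real^'n::finite) set"
  assumes \<Omega>: "open \<Omega>" "bounded \<Omega>" and M: "0 < M" "\<And>x. x \<in> \<Omega> \<Longrightarrow> x + M *\<^sub>R axis i 1 \<notin> \<Omega>"
    and f: "f \<in> borel_measurable (lebesgue_on \<Omega>)" "integrable (lebesgue_on \<Omega>) f"
      "integrable (lebesgue_on \<Omega>) (\<lambda>x. (f x)\<^sup>2)"
  obtains t where "t \<in> borel_measurable (lebesgue_on \<Omega>)" "integrable (lebesgue_on \<Omega>) (\<lambda>x. (t x)\<^sup>2)"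
    "(LINT x|lebesgue_on \<Omega>. (t x)\<^sup>2) \<le> M\<^sup>2 * (LINT x|lebesgue_on \<Omega>. (f x)\<^sup>2)"
    "\<And>\<phi>. \<phi> \<in> test_functions \<Omega> \<Longrightarrow>
       (LINT x|lebesgue_on \<Omega>. t x * partial_deriv i \<phi> x) = - (LINT x|lebesgue_on \<Omega>. f x * \<phi> x)"
proof -
  obtain w where w[measurable]: "w \<in> borel_measurable borel" and w0: "\<And>x. x \<notin> \<Omega> \<Longrightarrow> w x = 0"
    and AE: "AE x in lebesgue_on \<Omega>. f x = w x"
    using lebesgue_on_borel_representative[OF \<Omega>(1) f(1)] by blast
  have [measurable]: "\<Omega> \<in> sets borel" using \<Omega>(1) by simp
  have wm: "w \<in> borel_measurable (lebesgue_on \<Omega>)"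
    by (intro measurable_restrict_space1 measurable_completion) auto
  have ind: "indicator \<Omega> x * w x = w x" "indicator \<Omega> x * (w x)\<^sup>2 = (w x)\<^sup>2" for x
    using w0 by (auto simp: indicator_def)
  have "integrable (lebesgue_on \<Omega>) w"
    using f(2) AE wm f(1) by (subst (asm) integrable_cong_AE[of f _ w]) auto
  then have int: "integrable lborel w"
    by (simp add: LINT_lebesgue_on_borel ind)
  have "integrable (lebesgue_on \<Omega>) (\<lambda>x. (w x)\<^sup>2)"
    using f(3) AE wm f(1) by (subst (asm) integrable_cong_AE[of _ _ "\<lambda>x. (w x)\<^sup>2"]) auto
  then have int2: "integrable lborel (\<lambda>x. (w x)\<^sup>2)"
    by (simp add: LINT_lebesgue_on_borel ind)
  define t where "t = ray_integral M (- axis i 1) w"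
  have t[measurable]: "t \<in> borel_measurable borel"
    using integrable_ray_integral[OF int, of M "- axis i 1"] M by (auto simp: t_def)
  note t2 = ray_integral_L2[OF int int2 M(1), of "- axis i 1", folded t_def]
  have t2\<Omega>: "integrable lborel (\<lambda>x. indicator \<Omega> x * (t x)\<^sup>2)"
    using t2(1) integrable_mult_bounded[OF t2(1), of "indicator \<Omega>" 1] by (simp add: mult.commute indicator_def)
  show thesis
  proof (rule that[of t])
    show "t \<in> borel_measurable (lebesgue_on \<Omega>)"
      by (intro measurable_restrict_space1 measurable_completion) auto
    show "integrable (lebesgue_on \<Omega>) (\<lambda>x. (t x)\<^sup>2)"
      using t2\<Omega> by (simp add: LINT_lebesgue_on_borel)
    have "(LINT x|lebesgue_on \<Omega>. (t x)\<^sup>2) = (LINT x|lborel. indicator \<Omega> x * (t x)\<^sup>2)"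
      by (simp add: LINT_lebesgue_on_borel)
    also have "\<dots> \<le> (LINT x|lborel. (t x)\<^sup>2)"
      by (intro integral_mono[OF t2\<Omega> t2(1)]) (auto simp: indicator_def)
    also have "\<dots> \<le> M\<^sup>2 * (LINT x|lborel. (w x)\<^sup>2)" by (rule t2(2))
    also have "(LINT x|lborel. (w x)\<^sup>2) = (LINT x|lebesgue_on \<Omega>. (w x)\<^sup>2)"
      by (simp add: LINT_lebesgue_on_borel ind)
    also have "\<dots> = (LINT x|lebesgue_on \<Omega>. (f x)\<^sup>2)"
      using AE wm f(1) by (intro integral_cong_AE) auto
    finally show "(LINT x|lebesgue_on \<Omega>. (t x)\<^sup>2) \<le> M\<^sup>2 * (LINT x|lebesgue_on \<Omega>. (f x)\<^sup>2)" .
  next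
    fix \<phi> assume \<phi>: "\<phi> \<in> test_functions \<Omega>"
    note [measurable] = partial_deriv_borel[OF \<phi>]
    have \<phi>m[measurable]: "\<phi> \<in> borel_measurable borel"
      by (intro borel_measurable_continuous_onI test_function_continuous[OF \<phi>])
    obtain C where C: "\<And>x. \<bar>partial_deriv i \<phi> x\<bar> \<le> C"
      using test_function_partial_bounded[OF \<phi>] by blast
    have "(LINT x|lebesgue_on \<Omega>. t x * partial_deriv i \<phi> x) = (LINT x|lborel. t x * partial_deriv i \<phi> x)"
      using test_function_partial_outside[OF \<phi>]
      by (subst LINT_lebesgue_on_borel) (auto intro!: Bochner_Integration.integral_cong simp: indicator_def)
    also have "\<dots> = (LINT x|lborel. w x * ray_integral M (axis i 1) (partial_deriv i \<phi>) x)"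
      unfolding t_def using C M by (intro ray_integral_duality int) auto
    also have "\<dots> = (LINT x|lborel. indicator \<Omega> x * - (w x * \<phi> x))"
    proof (rule Bochner_Integration.integral_cong[OF refl])
      fix x
      show "w x * ray_integral M (axis i 1) (partial_deriv i \<phi>) x = indicator \<Omega> x * - (w x * \<phi> x)"
        using w0[of x] M(2)[of x] test_function_outside[OF \<phi>, of "x + M *\<^sub>R axis i 1"] M(1)
        by (cases "x \<in> \<Omega>") (simp_all add: ray_integral_partial_deriv[OF \<phi>])
    qed
    also have "\<dots> = (LINT x|lebesgue_on \<Omega>. - (w x * \<phi> x))"
      by (subst LINT_lebesgue_on_borel) auto
    also have "\<dots> = - (LINT x|lebesgue_on \<Omega>. w x * \<phi> x)"
      by simp
    also have "(LINT x|lebesgue_on \<Omega>. w x * \<phi> x) = (LINT x|lebesgue_on \<Omega>. f x * \<phi> x)"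
    proof (rule integral_cong_AE)
      have "\<phi> \<in> borel_measurable (lebesgue_on \<Omega>)"
        by (intro measurable_restrict_space1 measurable_completion) auto
      then show "(\<lambda>x. w x * \<phi> x) \<in> borel_measurable (lebesgue_on \<Omega>)"
        "(\<lambda>x. f x * \<phi> x) \<in> borel_measurable (lebesgue_on \<Omega>)" using wm f(1) by auto
      show "AE x in lebesgue_on \<Omega>. w x * \<phi> x = f x * \<phi> x" using AE by eventually_elim simp
    qed
    finally show "(LINT x|lebesgue_on \<Omega>. t x * partial_deriv i \<phi> x) = - (LINT x|lebesgue_on \<Omega>. f x * \<phi> x)" .
  qed
qed

section \<open>The space of square integrable fields\<close>

lemma L2_measurable: "f \<in> L2 \<Omega> \<Longrightarrow> f \<in> borel_measurable (lebesgue_on \<Omega>)"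
  by (simp add: L2_def)

lemma L2_norm_square_integrable: "f \<in> L2 \<Omega> \<Longrightarrow> integrable (lebesgue_on \<Omega>) (\<lambda>x. (norm (f x))\<^sup>2)"
  by (simp add: L2_def)

lemma L2_inner_integrable:
  assumes "f \<in> L2 \<Omega>" "g \<in> L2 \<Omega>"
  shows "integrable (lebesgue_on \<Omega>) (\<lambda>x. f x \<bullet> g x)"
proof (rule Bochner_Integration.integrable_bound)
  show "integrable (lebesgue_on \<Omega>) (\<lambda>x. (norm (f x))\<^sup>2 + (norm (g x))\<^sup>2)"
    using assms by (simp add: L2_norm_square_integrable)
  show "(\<lambda>x. f x \<bullet> g x) \<in> borel_measurable (lebesgue_on \<Omega>)"
    using assms by (intro borel_measurable_inner L2_measurable)
  show "AE x in lebesgue_on \<Omega>. norm (f x \<bullet> g x) \<le> norm ((norm (f x))\<^sup>2 + (norm (g x))\<^sup>2)"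
  proof (rule AE_I2)
    fix x
    have "\<bar>f x \<bullet> g x\<bar> \<le> norm (f x) * norm (g x)" by (rule Cauchy_Schwarz_ineq2)
    also have "\<dots> \<le> (norm (f x))\<^sup>2 + (norm (g x))\<^sup>2"
      using sum_squares_bound[of "norm (f x)" "norm (g x)"] mult_nonneg_nonneg[OF norm_ge_zero[of "f x"] norm_ge_zero[of "g x"]]
      by linarith
    finally show "norm (f x \<bullet> g x) \<le> norm ((norm (f x))\<^sup>2 + (norm (g x))\<^sup>2)" by simp
  qed
qed

lemma L2_add: assumes "f \<in> L2 \<Omega>" "g \<in> L2 \<Omega>" shows "(\<lambda>x. f x + g x) \<in> L2 \<Omega>"
proof -
  have "(norm (f x + g x))\<^sup>2 = (norm (f x))\<^sup>2 + 2 * (f x \<bullet> g x) + (norm (g x))\<^sup>2" for x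
    by (simp add: power2_norm_eq_inner inner_add_left inner_add_right inner_commute)
  then show ?thesis
    using assms L2_inner_integrable[OF assms] by (auto simp: L2_def)
qed

lemma L2_bounded_linear:
  assumes "bounded_linear T" "f \<in> L2 \<Omega>" shows "(\<lambda>x. T (f x)) \<in> L2 \<Omega>"
proof -
  have m: "(\<lambda>x. T (f x)) \<in> borel_measurable (lebesgue_on \<Omega>)"
    using assms(2) borel_measurable_continuous_onI[OF bounded_linear.continuous_on[OF assms(1) continuous_on_id]]
      measurable_compose[of f "lebesgue_on \<Omega>" borel T borel]
    by (simp add: L2_def)
  obtain K where K: "\<And>x. norm (T x) \<le> norm x * K"
    using bounded_linear.bounded[OF assms(1)] by blast
  have "integrable (lebesgue_on \<Omega>) (\<lambda>x. (norm (T (f x)))\<^sup>2)"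
  proof (rule Bochner_Integration.integrable_bound)
    show "integrable (lebesgue_on \<Omega>) (\<lambda>x. K\<^sup>2 * (norm (f x))\<^sup>2)"
      using assms(2) by (simp add: L2_def)
    show "(\<lambda>x. (norm (T (f x)))\<^sup>2) \<in> borel_measurable (lebesgue_on \<Omega>)"
      using m by auto
    have "(norm (T (f x)))\<^sup>2 \<le> K\<^sup>2 * (norm (f x))\<^sup>2" for x
      using power_mono[OF K[of "f x"] norm_ge_zero, of 2] by (simp add: power_mult_distrib mult.commute)
    then show "AE x in lebesgue_on \<Omega>. norm ((norm (T (f x)))\<^sup>2) \<le> norm (K\<^sup>2 * (norm (f x))\<^sup>2)"
      by (intro AE_I2) simp
  qed
  then show ?thesis using m by (simp add: L2_def)
qed

lemma L2_scaleR: "f \<in> L2 \<Omega> \<Longrightarrow> (\<lambda>x. c *\<^sub>R f x) \<in> L2 \<Omega>"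
  by (rule L2_bounded_linear[OF bounded_linear_scaleR_right])

lemma L2_component: "f \<in> L2 \<Omega> \<Longrightarrow> (\<lambda>x. f x $ i) \<in> L2 \<Omega>" for f :: "_ \<Rightarrow> ('b::euclidean_space)^'n"
  by (rule L2_bounded_linear[OF bounded_linear_vec_nth])

lemma L2_sum:
  assumes "finite I" "\<And>i. i \<in> I \<Longrightarrow> f i \<in> L2 \<Omega>" shows "(\<lambda>x. \<Sum>i\<in>I. f i x) \<in> L2 \<Omega>"
  using assms by (induction I rule: finite_induct) (auto simp: L2_add, simp add: L2_def)

lemma finite_measure_lebesgue_on_bounded_open:
  "open \<Omega> \<Longrightarrow> bounded \<Omega> \<Longrightarrow> finite_measure (lebesgue_on \<Omega>)"
  by (intro finite_measure_lebesgue_on lmeasurable_open)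

lemma L2_bounded:
  assumes "open \<Omega>" "bounded \<Omega>" "f \<in> borel_measurable (lebesgue_on \<Omega>)" "\<And>x. norm (f x) \<le> C"
  shows "f \<in> L2 \<Omega>"
proof -
  interpret finite_measure "lebesgue_on \<Omega>"
    using assms by (intro finite_measure_lebesgue_on_bounded_open)
  have "(norm (f x))\<^sup>2 \<le> C\<^sup>2" for x
    by (rule power_mono[OF assms(4)]) simp
  then have "integrable (lebesgue_on \<Omega>) (\<lambda>x. (norm (f x))\<^sup>2)"
    using assms(3) by (intro integrable_const_bound[where B = "C\<^sup>2"]) auto
  then show ?thesis using assms(3) by (simp add: L2_def)
qed

lemma L2_const: "open \<Omega> \<Longrightarrow> bounded \<Omega> \<Longrightarrow> (\<lambda>x. c) \<in> L2 \<Omega>"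
  by (rule L2_bounded) auto

lemma L2_integrable:
  fixes f :: "'a::euclidean_space \<Rightarrow> real"
  assumes "open \<Omega>" "bounded \<Omega>" "f \<in> L2 \<Omega>" shows "integrable (lebesgue_on \<Omega>) f"
  using L2_inner_integrable[OF assms(3) L2_const[OF assms(1,2), of 1]] by simp

lemma L2_inner_commute: "L2_inner \<Omega> f g = L2_inner \<Omega> g f"
  by (simp add: L2_inner_def inner_commute)

lemma L2_inner_nonneg: "0 \<le> L2_inner \<Omega> f f"
  by (simp add: L2_inner_def integral_nonneg_AE)

lemma L2_inner_axpy_left:
  assumes "f \<in> L2 \<Omega>" "g \<in> L2 \<Omega>" "h \<in> L2 \<Omega>"
  shows "L2_inner \<Omega> (\<lambda>x. f x + c *\<^sub>R g x) h = L2_inner \<Omega> f h + c * L2_inner \<Omega> g h"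
  using assms by (simp add: L2_inner_def inner_add_left L2_inner_integrable)

lemma L2_inner_axpy_right:
  assumes "f \<in> L2 \<Omega>" "g \<in> L2 \<Omega>" "h \<in> L2 \<Omega>"
  shows "L2_inner \<Omega> h (\<lambda>x. f x + c *\<^sub>R g x) = L2_inner \<Omega> h f + c * L2_inner \<Omega> h g"
  using L2_inner_axpy_left[OF assms] by (simp add: L2_inner_commute)

lemma L2_inner_axpy_square:
  assumes "f \<in> L2 \<Omega>" "g \<in> L2 \<Omega>"
  shows "L2_inner \<Omega> (\<lambda>x. f x + c *\<^sub>R g x) (\<lambda>x. f x + c *\<^sub>R g x)
       = L2_inner \<Omega> f f + 2 * c * L2_inner \<Omega> f g + c\<^sup>2 * L2_inner \<Omega> g g"
  using assms
  by (simp add: L2_inner_axpy_left L2_inner_axpy_right L2_add L2_scaleR L2_inner_commute[of _ g f]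
      power2_eq_square algebra_simps)

lemma L2_inner_cong_AE:
  assumes "f \<in> L2 \<Omega>" "f' \<in> L2 \<Omega>" "g \<in> L2 \<Omega>" "g' \<in> L2 \<Omega>"
    and "AE x in lebesgue_on \<Omega>. f x = f' x" "AE x in lebesgue_on \<Omega>. g x = g' x"
  shows "L2_inner \<Omega> f g = L2_inner \<Omega> f' g'"
  unfolding L2_inner_def
proof (rule integral_cong_AE)
  show "(\<lambda>x. f x \<bullet> g x) \<in> borel_measurable (lebesgue_on \<Omega>)" "(\<lambda>x. f' x \<bullet> g' x) \<in> borel_measurable (lebesgue_on \<Omega>)"
    using assms by (auto intro!: borel_measurable_inner simp: L2_measurable)
  show "AE x in lebesgue_on \<Omega>. f x \<bullet> g x = f' x \<bullet> g' x"
    using assms(5,6) by eventually_elim simp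
qed

lemma L2_inner_self_eq_0_imp:
  assumes "f \<in> L2 \<Omega>" "L2_inner \<Omega> f f = 0" shows "AE x in lebesgue_on \<Omega>. f x = 0"
  using integral_nonneg_eq_0_iff_AE[OF L2_inner_integrable[OF assms(1,1)]] assms(2)
  by (simp add: L2_inner_def)

section \<open>Deviatoric part\<close>

lemma inner_mat_1: "(A :: real^'n^'n::finite) \<bullet> mat 1 = trace A"
  by (simp add: inner_vec_def mat_def trace_def if_distrib cong: if_cong)

lemma mat_1_nth: "(mat 1 :: real^'n^'n::finite) $ i = axis i 1"
  by (simp add: mat_def axis_def vec_eq_iff)

text \<open>
  The deviator is the orthogonal projection along the identity matrix.
\<close>

lemma dev_inner_le: "dev A \<bullet> dev A \<le> A \<bullet> A" for A :: "real^'n^'n::finite"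
proof -
  define n where "n = real CARD('n)"
  have n: "0 < n" by (simp add: n_def)
  define s where "s = trace A / n"
  have "(mat 1 :: real^'n^'n) \<bullet> mat 1 = n"
    unfolding inner_mat_1 by (simp add: n_def trace_def mat_def)
  then have "dev A \<bullet> dev A = A \<bullet> A - 2 * s * trace A + s\<^sup>2 * n"
    unfolding dev_def n_def[symmetric] s_def[symmetric]
    by (simp add: inner_diff_left inner_diff_right inner_mat_1[of A] inner_commute[of "mat 1" A]
        power2_eq_square algebra_simps)
  also have "\<dots> = A \<bullet> A - (trace A)\<^sup>2 / n"
    using n by (simp add: s_def power2_eq_square field_simps)
  also have "\<dots> \<le> A \<bullet> A" using n by simp
  finally show ?thesis .
qed

lemma bounded_linear_trace: "bounded_linear (trace :: real^'n^'n::finite \<Rightarrow> real)"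
proof -
  have *: "trace = (\<lambda>A :: real^'n^'n. A \<bullet> mat 1)" by (simp add: inner_mat_1)
  show ?thesis unfolding * by (rule bounded_linear_inner_left)
qed

lemma bounded_linear_dev: "bounded_linear (dev :: real^'n^'n::finite \<Rightarrow> real^'n^'n)"
proof -
  have "bounded_linear (\<lambda>A :: real^'n^'n. A - ((A \<bullet> mat 1) / real CARD('n)) *\<^sub>R mat 1)"
    by (intro bounded_linear_sub bounded_linear_ident bounded_linear_scaleR_const
        bounded_linear_divide[THEN bounded_linear_compose] bounded_linear_inner_left)
  then show ?thesis by (simp add: dev_def[abs_def] inner_mat_1)
qed

lemma dev_axpy: "dev (A + c *\<^sub>R B) = dev A + c *\<^sub>R dev B"
  by (simp add: linear_add[OF bounded_linear.linear[OF bounded_linear_dev]]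
      linear_scale[OF bounded_linear.linear[OF bounded_linear_dev]])

lemma dev_mat_1: "dev (mat 1 :: real^'n^'n::finite) = 0"
  by (simp add: dev_def trace_def mat_def)

section \<open>The weak divergence\<close>

lemma test_function_L2:
  fixes \<Omega> :: "(real^'n::finite) set"
  assumes \<Omega>: "open \<Omega>" "bounded \<Omega>" and \<phi>: "\<phi> \<in> test_functions \<Omega>"
  shows "\<phi> \<in> L2 \<Omega>" "partial_deriv i \<phi> \<in> L2 \<Omega>" "grad \<phi> \<in> L2 \<Omega>"
proof -
  have meas: "g \<in> borel_measurable (lebesgue_on \<Omega>)" if "continuous_on UNIV g" for g :: "real^'n \<Rightarrow> real"
    using \<Omega> that by (intro continuous_imp_measurable_on_sets_lebesgue) (auto intro: continuous_on_subset)
  obtain C where C: "\<And>x. \<bar>\<phi> x\<bar> \<le> C" using test_function_bounded[OF \<phi>] by blast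
  show "\<phi> \<in> L2 \<Omega>"
    using C by (intro L2_bounded[OF \<Omega> meas[OF test_function_continuous[OF \<phi>]]]) simp
  show p: "partial_deriv i \<phi> \<in> L2 \<Omega>" for i
  proof -
    obtain D where D: "\<And>x. \<bar>partial_deriv i \<phi> x\<bar> \<le> D"
      using test_function_partial_bounded[OF \<phi>] by blast
    show ?thesis
      using D by (intro L2_bounded[OF \<Omega> meas[OF test_function_partial_continuous[OF \<phi>]]]) simp
  qed
  have "(\<lambda>x. \<Sum>i\<in>UNIV. partial_deriv i \<phi> x *\<^sub>R (axis i 1 :: real^'n)) \<in> L2 \<Omega>"
    by (intro L2_sum L2_bounded_linear[OF bounded_linear_scaleR_left p]) simp
  moreover have "(\<lambda>x. \<Sum>i\<in>UNIV. partial_deriv i \<phi> x *\<^sub>R axis i 1) = grad \<phi>"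
    by (auto simp: grad_def vec_eq_iff axis_def if_distrib cong: if_cong)
  ultimately show "grad \<phi> \<in> L2 \<Omega>" by simp
qed

lemma has_L2_row_div_unique:
  assumes \<Omega>: "open \<Omega>" "bounded \<Omega>" and g: "has_L2_row_div \<Omega> \<tau> g" and h: "has_L2_row_div \<Omega> \<tau> h"
  shows "AE x in lebesgue_on \<Omega>. g x = h x"
proof -
  have L2: "g \<in> L2 \<Omega>" "h \<in> L2 \<Omega>" using g h by (auto simp: has_L2_row_div_def)
  have "AE x in lebesgue_on \<Omega>. g x $ i - h x $ i = 0" for i
  proof (rule integral_against_test_functions_zero_imp_AE_zero[OF \<Omega>(1)])
    show "integrable (lebesgue_on \<Omega>) (\<lambda>x. g x $ i - h x $ i)"
      using L2 by (intro Bochner_Integration.integrable_diff L2_integrable[OF \<Omega>] L2_component)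
    fix \<phi> assume \<phi>: "\<phi> \<in> test_functions \<Omega>"
    have int: "integrable (lebesgue_on \<Omega>) (\<lambda>x. f x $ i * \<phi> x)" if "f \<in> L2 \<Omega>" for f :: "_ \<Rightarrow> real^'a"
      using L2_inner_integrable[OF L2_component[OF that, of i] test_function_L2(1)[OF \<Omega> \<phi>]] by simp
    have "(LINT x|lebesgue_on \<Omega>. g x $ i * \<phi> x) = (LINT x|lebesgue_on \<Omega>. h x $ i * \<phi> x)"
      using g h \<phi> by (auto simp: has_L2_row_div_def has_weak_div_def)
    then show "(LINT x|lebesgue_on \<Omega>. (g x $ i - h x $ i) * \<phi> x) = 0"
      using int L2 by (simp add: left_diff_distrib)
  qed
  then have "AE x in lebesgue_on \<Omega>. \<forall>i. g x $ i - h x $ i = 0"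
    by (simp add: AE_all_countable)
  then show ?thesis by eventually_elim (simp add: vec_eq_iff)
qed

lemma has_L2_row_div_axpy:
  assumes \<Omega>: "open \<Omega>" "bounded \<Omega>" and L2: "\<sigma> \<in> L2 \<Omega>" "\<tau> \<in> L2 \<Omega>"
    and g: "has_L2_row_div \<Omega> \<sigma> g" and h: "has_L2_row_div \<Omega> \<tau> h"
  shows "has_L2_row_div \<Omega> (\<lambda>x. \<sigma> x + c *\<^sub>R \<tau> x) (\<lambda>x. g x + c *\<^sub>R h x)"
  unfolding has_L2_row_div_def has_weak_div_def
proof (intro conjI allI ballI)
  have gh: "g \<in> L2 \<Omega>" "h \<in> L2 \<Omega>" using g h by (auto simp: has_L2_row_div_def)
  then show "(\<lambda>x. g x + c *\<^sub>R h x) \<in> L2 \<Omega>" by (intro L2_add L2_scaleR)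
  fix i \<phi> assume \<phi>: "\<phi> \<in> test_functions \<Omega>"
  have int: "integrable (lebesgue_on \<Omega>) (\<lambda>x. f x $ i * \<phi> x)" if "f \<in> L2 \<Omega>" for f :: "_ \<Rightarrow> real^'a"
    using L2_inner_integrable[OF L2_component[OF that, of i] test_function_L2(1)[OF \<Omega> \<phi>]] by simp
  have int': "integrable (lebesgue_on \<Omega>) (\<lambda>x. f x $ i \<bullet> grad \<phi> x)" if "f \<in> L2 \<Omega>" for f :: "_ \<Rightarrow> real^'a^'a"
    using L2_inner_integrable[OF L2_component[OF that, of i] test_function_L2(3)[OF \<Omega> \<phi>]] by simp
  have eq: "(LINT x|lebesgue_on \<Omega>. \<sigma> x $ i \<bullet> grad \<phi> x) = - (LINT x|lebesgue_on \<Omega>. g x $ i * \<phi> x)"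
    "(LINT x|lebesgue_on \<Omega>. \<tau> x $ i \<bullet> grad \<phi> x) = - (LINT x|lebesgue_on \<Omega>. h x $ i * \<phi> x)"
    using g h \<phi> by (auto simp: has_L2_row_div_def has_weak_div_def)
  have "(LINT x|lebesgue_on \<Omega>. (\<sigma> x + c *\<^sub>R \<tau> x) $ i \<bullet> grad \<phi> x)
      = (LINT x|lebesgue_on \<Omega>. \<sigma> x $ i \<bullet> grad \<phi> x) + c * (LINT x|lebesgue_on \<Omega>. \<tau> x $ i \<bullet> grad \<phi> x)"
    using int' L2 by (simp add: inner_add_left)
  also have "\<dots> = - (LINT x|lebesgue_on \<Omega>. (g x + c *\<^sub>R h x) $ i * \<phi> x)"
    using int gh by (simp add: eq distrib_right mult.assoc)
  finally show "(LINT x|lebesgue_on \<Omega>. (\<sigma> x + c *\<^sub>R \<tau> x) $ i \<bullet> grad \<phi> x)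
      = - (LINT x|lebesgue_on \<Omega>. (g x + c *\<^sub>R h x) $ i * \<phi> x)" .
qed

lemma row_div: "\<tau> \<in> stress_space \<Omega> \<Longrightarrow> has_L2_row_div \<Omega> \<tau> (row_div \<Omega> \<tau>)"
  unfolding stress_space_def row_div_def by (auto simp: some_eq_ex)

lemma stress_space_L2:
  assumes "\<tau> \<in> stress_space \<Omega>"
  shows "\<tau> \<in> L2 \<Omega>" "(\<lambda>x. dev (\<tau> x)) \<in> L2 \<Omega>" "row_div \<Omega> \<tau> \<in> L2 \<Omega>"
  using assms row_div[OF assms]
  by (auto simp: stress_space_def has_L2_row_div_def intro: L2_bounded_linear[OF bounded_linear_dev])

lemma row_div_AE_eq:
  assumes "open \<Omega>" "bounded \<Omega>" "\<tau> \<in> stress_space \<Omega>" "has_L2_row_div \<Omega> \<tau> g"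
  shows "AE x in lebesgue_on \<Omega>. row_div \<Omega> \<tau> x = g x"
  using has_L2_row_div_unique[OF assms(1,2) row_div[OF assms(3)] assms(4)] .

lemma stress_space_axpy:
  assumes \<Omega>: "open \<Omega>" "bounded \<Omega>" and \<sigma>: "\<sigma> \<in> stress_space \<Omega>" and \<tau>: "\<tau> \<in> stress_space \<Omega>"
  shows "(\<lambda>x. \<sigma> x + c *\<^sub>R \<tau> x) \<in> stress_space \<Omega>"
proof -
  note L2 = stress_space_L2(1)[OF \<sigma>] stress_space_L2(1)[OF \<tau>]
  have tr: "trace (A + c *\<^sub>R B) = trace A + c * trace B" for A B :: "real^'a^'a"
    by (simp add: inner_mat_1[symmetric] inner_add_left)
  have int: "integrable (lebesgue_on \<Omega>) (\<lambda>x. trace (f x))" if "f \<in> L2 \<Omega>" for f :: "_ \<Rightarrow> real^'a^'a"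
    using L2_integrable[OF \<Omega> L2_bounded_linear[OF bounded_linear_trace that]] .
  have "AE x in lebesgue_on \<Omega>. transpose (\<sigma> x) = \<sigma> x" "AE x in lebesgue_on \<Omega>. transpose (\<tau> x) = \<tau> x"
    using \<sigma> \<tau> by (auto simp: stress_space_def)
  then have "AE x in lebesgue_on \<Omega>. transpose (\<sigma> x + c *\<^sub>R \<tau> x) = \<sigma> x + c *\<^sub>R \<tau> x"
    by eventually_elim (simp add: transpose_def vec_eq_iff)
  moreover have "(LINT x|lebesgue_on \<Omega>. trace (\<sigma> x + c *\<^sub>R \<tau> x)) = 0"
    using \<sigma> \<tau> int L2 by (simp add: tr stress_space_def)
  ultimately show ?thesis
    using has_L2_row_div_axpy[OF \<Omega> L2 row_div[OF \<sigma>] row_div[OF \<tau>]] L2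
    by (auto simp: stress_space_def intro: L2_add L2_scaleR)
qed

lemma row_div_axpy:
  assumes "open \<Omega>" "bounded \<Omega>" "\<sigma> \<in> stress_space \<Omega>" "\<tau> \<in> stress_space \<Omega>" "has_L2_row_div \<Omega> \<tau> u"
  shows "AE x in lebesgue_on \<Omega>. row_div \<Omega> (\<lambda>x. \<sigma> x + c *\<^sub>R \<tau> x) x = row_div \<Omega> \<sigma> x + c *\<^sub>R u x"
  using assms
  by (intro row_div_AE_eq stress_space_axpy has_L2_row_div_axpy row_div stress_space_L2)

lemma measure_lebesgue_on_open_pos:
  assumes "open \<Omega>" "bounded \<Omega>" "\<Omega> \<noteq> {}" shows "0 < measure (lebesgue_on \<Omega>) \<Omega>"
proof -
  have "measure lebesgue \<Omega> \<noteq> 0"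
    using assms open_not_negligible negligible_iff_measure lmeasurable_open by blast
  moreover have "measure (lebesgue_on \<Omega>) \<Omega> = measure lebesgue \<Omega>"
    using assms(1) by (intro measure_restrict_space) auto
  ultimately show ?thesis by (simp add: zero_less_measure_iff)
qed

text \<open>
  A field with vanishing deviator is \<open>p\<close> times the identity, and its divergence is the gradient of \<open>p\<close>. If that
  vanishes as well, \<open>p\<close> is constant, and the normalization of the trace leaves only zero.
\<close>

lemma dev_row_div_zero_imp_zero:
  fixes \<Omega> :: "(real^'n::finite) set"
  assumes \<Omega>: "open \<Omega>" "bounded \<Omega>" "connected \<Omega>" "\<Omega> \<noteq> {}" and \<sigma>: "\<sigma> \<in> stress_space \<Omega>"
    and dev: "AE x in lebesgue_on \<Omega>. dev (\<sigma> x) = 0"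
    and div: "AE x in lebesgue_on \<Omega>. row_div \<Omega> \<sigma> x = 0"
  shows "AE x in lebesgue_on \<Omega>. \<sigma> x = 0"
proof -
  define p where "p x = trace (\<sigma> x) / real CARD('n)" for x
  have \<sigma>L2: "\<sigma> \<in> L2 \<Omega>" by (rule stress_space_L2[OF \<sigma>])
  have spherical: "AE x in lebesgue_on \<Omega>. \<sigma> x = p x *\<^sub>R mat 1"
    using dev by eventually_elim (simp add: dev_def p_def)
  have int: "integrable (lebesgue_on \<Omega>) (\<lambda>x. trace (\<sigma> x))"
    by (rule L2_integrable[OF \<Omega>(1,2) L2_bounded_linear[OF bounded_linear_trace \<sigma>L2]])
  then have intp: "integrable (lebesgue_on \<Omega>) p" by (simp add: p_def[abs_def])
  have "(LINT x|lebesgue_on \<Omega>. p x * partial_deriv i \<phi> x) = 0" if \<phi>: "\<phi> \<in> test_functions \<Omega>" for i \<phi>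
  proof -
    have "(LINT x|lebesgue_on \<Omega>. p x * partial_deriv i \<phi> x) = (LINT x|lebesgue_on \<Omega>. \<sigma> x $ i \<bullet> grad \<phi> x)"
    proof (rule integral_cong_AE)
      show "(\<lambda>x. p x * partial_deriv i \<phi> x) \<in> borel_measurable (lebesgue_on \<Omega>)"
        using intp L2_measurable[OF test_function_L2(2)[OF \<Omega>(1,2) \<phi>, of i]] by auto
      show "(\<lambda>x. \<sigma> x $ i \<bullet> grad \<phi> x) \<in> borel_measurable (lebesgue_on \<Omega>)"
        using L2_component[OF \<sigma>L2, of i] test_function_L2(3)[OF \<Omega>(1,2) \<phi>]
        by (intro borel_measurable_inner L2_measurable)
      show "AE x in lebesgue_on \<Omega>. p x * partial_deriv i \<phi> x = \<sigma> x $ i \<bullet> grad \<phi> x"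
        using spherical
        by eventually_elim
           (simp add: mat_1_nth inner_axis' grad_def)
    qed
    also have "\<dots> = - (LINT x|lebesgue_on \<Omega>. row_div \<Omega> \<sigma> x $ i * \<phi> x)"
      using row_div[OF \<sigma>] \<phi> by (auto simp: has_L2_row_div_def has_weak_div_def)
    also have "(LINT x|lebesgue_on \<Omega>. row_div \<Omega> \<sigma> x $ i * \<phi> x) = 0"
      by (rule integral_eq_zero_AE) (use div in \<open>auto elim: eventually_mono\<close>)
    finally show ?thesis by simp
  qed
  then obtain c where c: "AE x in lebesgue_on \<Omega>. p x = c"
    using weak_gradient_zero_imp_constant[OF \<Omega>(1,3) intp] by blast
  have "0 = (LINT x|lebesgue_on \<Omega>. p x)"
    using \<sigma> by (simp add: p_def stress_space_def)
  also have "\<dots> = (LINT x|lebesgue_on \<Omega>. c)"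
    using intp c by (intro integral_cong_AE) auto
  also have "\<dots> = c * measure (lebesgue_on \<Omega>) \<Omega>"
    by simp
  finally have "c = 0"
    using measure_lebesgue_on_open_pos[OF \<Omega>(1,2,4)] by simp
  from spherical c show ?thesis
    by eventually_elim (simp add: \<open>c = 0\<close>)
qed

section \<open>A bounded right inverse of the divergence\<close>

text \<open>
  Stresses satisfy no boundary condition, so a diagonal matrix suffices: its \<open>i\<close>-th diagonal entry is the
  antiderivative of \<open>u $ i\<close> along the \<open>i\<close>-th axis. A constant multiple of the identity corrects the mean of the
  trace and affects neither the divergence nor the deviator.
\<close>

lemma symmetric_right_inverse_of_divergence:
  fixes \<Omega> :: "(real^'n::finite) set"
  assumes \<Omega>: "open \<Omega>" "bounded \<Omega>" "\<Omega> \<noteq> {}"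
  obtains C where "0 \<le> C" "\<And>u. u \<in> L2 \<Omega> \<Longrightarrow> \<exists>\<tau>\<in>stress_space \<Omega>. has_L2_row_div \<Omega> \<tau> u \<and>
      L2_inner \<Omega> (\<lambda>x. dev (\<tau> x)) (\<lambda>x. dev (\<tau> x)) \<le> C * L2_inner \<Omega> u u"
proof -
  obtain R where R: "\<And>x. x \<in> \<Omega> \<Longrightarrow> norm x \<le> R" "0 < R"
    using \<Omega>(2) by (metis bounded_pos)
  \<comment> \<open>Any length above the diameter bound \<open>2 * R\<close> works.\<close>
  define M where "M = 3 * R"
  have M: "0 < M" using R by (simp add: M_def)
  have out: "x + M *\<^sub>R axis i 1 \<notin> \<Omega>" if "x \<in> \<Omega>" for x i
  proof
    assume "x + M *\<^sub>R axis i 1 \<in> \<Omega>"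
    then have "norm (M *\<^sub>R axis i 1 :: real^'n) \<le> R + R"
      using R(1)[OF that] R(1)[of "x + M *\<^sub>R axis i 1"] norm_triangle_ineq4[of "x + M *\<^sub>R axis i 1" x] by simp
    then show False using R(2) by (simp add: M_def)
  qed
  show thesis
  proof (rule that[of "M\<^sup>2"])
    fix u :: "real^'n \<Rightarrow> real^'n" assume u: "u \<in> L2 \<Omega>"
    define P where "P i t \<longleftrightarrow> t \<in> borel_measurable (lebesgue_on \<Omega>) \<and>
      integrable (lebesgue_on \<Omega>) (\<lambda>x. (t x)\<^sup>2) \<and>
      (LINT x|lebesgue_on \<Omega>. (t x)\<^sup>2) \<le> M\<^sup>2 * (LINT x|lebesgue_on \<Omega>. (u x $ i)\<^sup>2) \<and>
      (\<forall>\<phi>\<in>test_functions \<Omega>.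
       (LINT x|lebesgue_on \<Omega>. t x * partial_deriv i \<phi> x) = - (LINT x|lebesgue_on \<Omega>. u x $ i * \<phi> x))" for i t
    have "\<exists>t. P i t" for i
    proof -
      have ui: "(\<lambda>x. u x $ i) \<in> L2 \<Omega>" by (rule L2_component[OF u])
      then have ui2: "integrable (lebesgue_on \<Omega>) (\<lambda>x. (u x $ i)\<^sup>2)" by (simp add: L2_def)
      show ?thesis
      proof (rule directional_antiderivative[OF \<Omega>(1,2) M _ L2_measurable[OF ui] L2_integrable[OF \<Omega>(1,2) ui] ui2])
        show "x + M *\<^sub>R axis i 1 \<notin> \<Omega>" if "x \<in> \<Omega>" for x by (rule out[OF that])
      qed (unfold P_def, blast)
    qed
    then obtain t where "\<And>i. P i (t i)" by metis
    then have t: "\<And>i. t i \<in> borel_measurable (lebesgue_on \<Omega>)"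
      "\<And>i. integrable (lebesgue_on \<Omega>) (\<lambda>x. (t i x)\<^sup>2)"
      "\<And>i. (LINT x|lebesgue_on \<Omega>. (t i x)\<^sup>2) \<le> M\<^sup>2 * (LINT x|lebesgue_on \<Omega>. (u x $ i)\<^sup>2)"
      "\<And>i \<phi>. \<phi> \<in> test_functions \<Omega> \<Longrightarrow>
       (LINT x|lebesgue_on \<Omega>. t i x * partial_deriv i \<phi> x) = - (LINT x|lebesgue_on \<Omega>. u x $ i * \<phi> x)"
      unfolding P_def by blast+
    have tL2: "t i \<in> L2 \<Omega>" for i using t(1,2) by (simp add: L2_def)
    define E :: "'n \<Rightarrow> real^'n^'n" where "E i = (\<chi> a b. if a = i \<and> b = i then 1 else 0)" for i
    define D where "D x = (\<Sum>i\<in>UNIV. t i x *\<^sub>R E i)" for x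
    have D: "D x $ a $ b = (if a = b then t a x else 0)" for x a b
      by (cases "a = b") (auto simp: D_def E_def if_distrib intro!: sum.neutral cong: if_cong)
    have DL2: "D \<in> L2 \<Omega>"
      unfolding D_def[abs_def] by (intro L2_sum L2_bounded_linear[OF bounded_linear_scaleR_left tL2]) simp
    define m where "m = (LINT x|lebesgue_on \<Omega>. trace (D x)) / (real CARD('n) * measure (lebesgue_on \<Omega>) \<Omega>)"
    define \<tau> where "\<tau> x = D x + (- m) *\<^sub>R mat 1" for x
    have \<tau>L2: "\<tau> \<in> L2 \<Omega>"
      unfolding \<tau>_def[abs_def] by (intro L2_add DL2 L2_scaleR L2_const \<Omega>)
    have div: "has_L2_row_div \<Omega> \<tau> u"
      unfolding has_L2_row_div_def has_weak_div_def
    proof (intro conjI u allI ballI)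
      fix i \<phi> assume \<phi>: "\<phi> \<in> test_functions \<Omega>"
      have pL2: "partial_deriv i \<phi> \<in> L2 \<Omega>" by (rule test_function_L2[OF \<Omega>(1,2) \<phi>])
      have "\<tau> x $ i \<bullet> grad \<phi> x = t i x * partial_deriv i \<phi> x - m * partial_deriv i \<phi> x" for x
      proof -
        have "\<tau> x $ i \<bullet> grad \<phi> x = (\<Sum>j\<in>UNIV. if j = i then (t i x - m) * partial_deriv i \<phi> x else 0)"
          unfolding inner_vec_def by (intro sum.cong) (auto simp: \<tau>_def D mat_def grad_def)
        then show ?thesis by (simp add: left_diff_distrib)
      qed
      then have "(LINT x|lebesgue_on \<Omega>. \<tau> x $ i \<bullet> grad \<phi> x)
          = (LINT x|lebesgue_on \<Omega>. t i x * partial_deriv i \<phi> x) - m * (LINT x|lebesgue_on \<Omega>. partial_deriv i \<phi> x)"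
        using L2_inner_integrable[OF tL2[of i] pL2] L2_integrable[OF \<Omega>(1,2) pL2] by simp
      also have "\<dots> = - (LINT x|lebesgue_on \<Omega>. u x $ i * \<phi> x)"
        using t(4)[OF \<phi>] integral_partial_deriv_zero[OF \<Omega>(1,2) \<phi>] by simp
      finally show "(LINT x|lebesgue_on \<Omega>. \<tau> x $ i \<bullet> grad \<phi> x) = - (LINT x|lebesgue_on \<Omega>. u x $ i * \<phi> x)" .
    qed
    have "transpose (\<tau> x) = \<tau> x" for x
      by (auto simp: transpose_def vec_eq_iff \<tau>_def D mat_def)
    moreover have "(LINT x|lebesgue_on \<Omega>. trace (\<tau> x)) = 0"
    proof -
      interpret finite_measure "lebesgue_on \<Omega>"
        using \<Omega> by (intro finite_measure_lebesgue_on_bounded_open)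
      have "trace (\<tau> x) = trace (D x) - m * real CARD('n)" for x
        by (simp add: trace_def \<tau>_def mat_def sum_subtractf)
      then have "(LINT x|lebesgue_on \<Omega>. trace (\<tau> x))
          = (LINT x|lebesgue_on \<Omega>. trace (D x)) - m * real CARD('n) * measure (lebesgue_on \<Omega>) \<Omega>"
        using L2_integrable[OF \<Omega>(1,2) L2_bounded_linear[OF bounded_linear_trace DL2]] by simp
      then show ?thesis
        using measure_lebesgue_on_open_pos[OF \<Omega>] by (simp add: m_def)
    qed
    ultimately have \<tau>: "\<tau> \<in> stress_space \<Omega>"
      using div \<tau>L2 by (auto simp: stress_space_def)
    have D2: "D x \<bullet> D x = (\<Sum>i\<in>UNIV. (t i x)\<^sup>2)" for x
      by (simp add: inner_vec_def D power2_eq_square if_distrib cong: if_cong)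
    have "L2_inner \<Omega> (\<lambda>x. dev (\<tau> x)) (\<lambda>x. dev (\<tau> x)) \<le> L2_inner \<Omega> D D"
      unfolding L2_inner_def
    proof (rule integral_mono)
      show "dev (\<tau> x) \<bullet> dev (\<tau> x) \<le> D x \<bullet> D x" for x
        using dev_inner_le[of "D x"] by (simp add: \<tau>_def dev_axpy dev_mat_1 del: scaleR_minus_left)
    qed (auto intro: L2_inner_integrable DL2 stress_space_L2[OF \<tau>])
    also have "\<dots> = (\<Sum>i\<in>UNIV. LINT x|lebesgue_on \<Omega>. (t i x)\<^sup>2)"
      using t(2) by (simp add: L2_inner_def D2)
    also have "\<dots> \<le> (\<Sum>i\<in>UNIV. M\<^sup>2 * (LINT x|lebesgue_on \<Omega>. (u x $ i)\<^sup>2))"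
      by (intro sum_mono t)
    also have "\<dots> = M\<^sup>2 * L2_inner \<Omega> u u"
    proof -
      have "integrable (lebesgue_on \<Omega>) (\<lambda>x. (u x $ i)\<^sup>2)" for i
        using L2_component[OF u, of i] by (simp add: L2_def)
      then show ?thesis
        by (simp add: L2_inner_def inner_vec_def sum_distrib_left flip: power2_eq_square)
    qed
    finally show "\<exists>\<tau>\<in>stress_space \<Omega>. has_L2_row_div \<Omega> \<tau> u \<and>
      L2_inner \<Omega> (\<lambda>x. dev (\<tau> x)) (\<lambda>x. dev (\<tau> x)) \<le> M\<^sup>2 * L2_inner \<Omega> u u"
      using \<tau> div by blast
  qed simp
qed

section \<open>The inf-sup condition\<close>

text \<open>
  The squared norms add up to a quadratic form, which is what the expansions below produce; up to constants it is
  the square of \<open>pair_norm\<close>.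
\<close>

definition energy ::
    "real \<Rightarrow> (real^'n::finite) set \<Rightarrow>
     (real^'n \<Rightarrow> real^'n^'n) \<times> (real^'n \<Rightarrow> real^'n) \<Rightarrow> real" where
  "energy \<kappa> \<Omega> = (\<lambda>(\<tau>, v). (stress_norm \<kappa> \<Omega> \<tau>)\<^sup>2 + (velocity_norm \<kappa> \<Omega> v)\<^sup>2)"

lemma energy_eq:
  assumes "0 < \<kappa>"
  shows "energy \<kappa> \<Omega> (\<tau>, v) =
    L2_inner \<Omega> (\<lambda>x. dev (\<tau> x)) (\<lambda>x. dev (\<tau> x))
    + kappa_tilde \<kappa> * L2_inner \<Omega> (row_div \<Omega> \<tau>) (row_div \<Omega> \<tau>)
    + L2_inner \<Omega> v v / kappa_tilde \<kappa>"
  using assms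
  by (simp add: energy_def stress_norm_def velocity_norm_def L2_inner_nonneg kappa_tilde_def
      real_sqrt_pow2 divide_inverse mult.commute)

lemma pair_norm_le: "pair_norm \<kappa> \<Omega> q \<le> sqrt (2 * energy \<kappa> \<Omega> q)"
proof -
  have "(s + t)\<^sup>2 \<le> 2 * (s\<^sup>2 + t\<^sup>2)" for s t :: real
    using sum_squares_bound[of s t] by (simp add: power2_sum)
  then show ?thesis
    by (intro real_le_rsqrt) (simp add: pair_norm_def energy_def split: prod.split)
qed

lemma pair_norm_pos:
  assumes "0 < \<kappa>" "0 < energy \<kappa> \<Omega> q" shows "0 < pair_norm \<kappa> \<Omega> q"
proof -
  obtain \<tau> v where q: "q = (\<tau>, v)" by fastforce
  have "0 \<le> stress_norm \<kappa> \<Omega> \<tau>" "0 \<le> velocity_norm \<kappa> \<Omega> v"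
    using assms(1) by (auto simp: stress_norm_def velocity_norm_def L2_inner_nonneg kappa_tilde_def)
  moreover have "stress_norm \<kappa> \<Omega> \<tau> \<noteq> 0 \<or> velocity_norm \<kappa> \<Omega> v \<noteq> 0"
    using assms(2) by (auto simp: energy_def q)
  ultimately show ?thesis by (auto simp: pair_norm_def q)
qed

text \<open>
  Division by zero gives zero, so the quotients in the inf-sup condition are meaningful only because the norms
  separate nonzero pairs from zero.
\<close>

lemma energy_pos:
  fixes \<Omega> :: "(real^'n::finite) set"
  assumes \<Omega>: "open \<Omega>" "bounded \<Omega>" "connected \<Omega>" "\<Omega> \<noteq> {}" and \<kappa>: "0 < \<kappa>"
    and q: "q \<in> nonzero_pairs \<Omega>"
  shows "0 < energy \<kappa> \<Omega> q"
proof (rule ccontr)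
  assume nonpos: "\<not> 0 < energy \<kappa> \<Omega> q"
  obtain \<tau> v where q': "q = (\<tau>, v)" by fastforce
  have \<tau>: "\<tau> \<in> stress_space \<Omega>" and v: "v \<in> L2 \<Omega>"
    and nz: "\<not> (AE x in lebesgue_on \<Omega>. \<tau> x = 0 \<and> v x = 0)"
    using q by (auto simp: nonzero_pairs_def velocity_space_def q')
  have k: "0 < kappa_tilde \<kappa>" using \<kappa> by (simp add: kappa_tilde_def)
  define a d w where "a = L2_inner \<Omega> (\<lambda>x. dev (\<tau> x)) (\<lambda>x. dev (\<tau> x))"
    and "d = L2_inner \<Omega> (row_div \<Omega> \<tau>) (row_div \<Omega> \<tau>)" and "w = L2_inner \<Omega> v v"
  have "a + kappa_tilde \<kappa> * d + w / kappa_tilde \<kappa> \<le> 0"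
    using nonpos by (simp add: q' energy_eq[OF \<kappa>] a_def d_def w_def)
  moreover have "0 \<le> a" "0 \<le> kappa_tilde \<kappa> * d" "0 \<le> w / kappa_tilde \<kappa>"
    using k by (simp_all add: a_def d_def w_def L2_inner_nonneg)
  ultimately have "a = 0" "kappa_tilde \<kappa> * d = 0" "w / kappa_tilde \<kappa> = 0" by linarith+
  then have "a = 0" "d = 0" "w = 0" using k by auto
  then have "AE x in lebesgue_on \<Omega>. dev (\<tau> x) = 0" "AE x in lebesgue_on \<Omega>. row_div \<Omega> \<tau> x = 0"
    and v0: "AE x in lebesgue_on \<Omega>. v x = 0"
    using stress_space_L2[OF \<tau>] v by (auto simp: a_def d_def w_def intro: L2_inner_self_eq_0_imp)
  then have "AE x in lebesgue_on \<Omega>. \<tau> x = 0"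
    using dev_row_div_zero_imp_zero[OF \<Omega> \<tau>] by blast
  with v0 have "AE x in lebesgue_on \<Omega>. \<tau> x = 0 \<and> v x = 0" by eventually_elim simp
  with nz show False by blast
qed

text \<open>
  The algebra behind the choice of test pair, with \<open>a\<close>, \<open>b\<close>, \<open>c\<close> for the inner products of the deviators of
  \<open>\<sigma>\<close> and of the lift \<open>\<rho>\<close> of \<open>u\<close>, \<open>d\<close> and \<open>w\<close> for the squared norms of \<open>div \<sigma>\<close> and
  \<open>u\<close>, and \<open>e\<close> for the inner product of the latter two. The last two quadratic assumptions replace
  Cauchy-Schwarz and Young: they say that \<open>dev (\<sigma> + \<delta> \<rho>)\<close> and \<open>div \<sigma> - u / \<kappa>\<close> have nonnegative
  squared norm. The right-hand side is the bilinear form at the test pair, before the two terms \<open>e\<close> cancel.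
\<close>

lemma test_pair_lower_bound:
  fixes a b c d e w k \<kappa> \<delta> C :: real
  assumes \<kappa>: "0 < \<kappa>" and k: "k = min \<kappa> 1" and \<delta>: "0 < \<delta>" "\<delta> \<le> 1 / 2" "\<delta> * C \<le> 1"
    and nonneg: "0 \<le> a" "0 \<le> d" "0 \<le> w" and c: "c \<le> C * w"
    and b: "0 \<le> a + 2 * \<delta> * b + \<delta>\<^sup>2 * c"
    and e: "0 \<le> d + 2 * (- inverse \<kappa>) * e + (- inverse \<kappa>)\<^sup>2 * w"
  shows "\<delta> / 2 * (a + k * d + w / k) \<le>
      1 / 2 * (a + \<delta> * b) + (e + \<delta> * w) - (e + (- k) * d) + inverse \<kappa> * (w + (- k) * e)"
proof -
  have k0: "0 < k" "k \<le> \<kappa>" "k \<le> 1" using \<kappa> k by auto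
  have "\<delta>\<^sup>2 * c \<le> \<delta>\<^sup>2 * (C * w)" by (intro mult_left_mono c) simp
  also have "\<dots> = \<delta> * w * (\<delta> * C)" by (simp add: power2_eq_square)
  also have "\<dots> \<le> \<delta> * w * 1" using \<delta> nonneg by (intro mult_left_mono) auto
  finally have dev: "- a / 4 - \<delta> * w / 4 \<le> 1 / 2 * (\<delta> * b)" using b by (simp add: algebra_simps)
  have "0 \<le> k / 2 * (d + 2 * (- inverse \<kappa>) * e + (- inverse \<kappa>)\<^sup>2 * w)"
    using e k0 by simp
  then have "inverse \<kappa> * k * e \<le> k * d / 2 + k * inverse \<kappa> * (inverse \<kappa> * w) / 2"
    by (simp add: power2_eq_square algebra_simps)
  also have "k * inverse \<kappa> * (inverse \<kappa> * w) \<le> 1 * (inverse \<kappa> * w)"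
    using k0 \<kappa> nonneg by (intro mult_right_mono) (auto simp: field_simps)
  finally have coupling: "inverse \<kappa> * k * e \<le> k * d / 2 + inverse \<kappa> * w / 2" by simp
  \<comment> \<open>For \<open>\<kappa> \<le> 1\<close> the zeroth-order term controls the velocity norm; for \<open>\<kappa> > 1\<close>, where it
    degenerates, \<open>k = 1\<close> and the lift term takes over.\<close>
  have vel: "\<delta> * (w / k) \<le> \<delta> * w + inverse \<kappa> * w"
  proof (cases "\<kappa> \<le> 1")
    case True
    then have "\<delta> * (w / k) \<le> 1 * (w / k)" using \<delta> nonneg k0 by (intro mult_right_mono) auto
    moreover have "w / k = inverse \<kappa> * w" using True k by (simp add: divide_inverse)
    moreover have "0 \<le> \<delta> * w" using \<delta> nonneg by simp
    ultimately show ?thesis by simp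
  next
    case False
    then have "k = 1" using k by simp
    then show ?thesis using \<kappa> nonneg by simp
  qed
  have damp: "\<delta> * a \<le> 1 / 2 * a" "\<delta> * (k * d) \<le> 1 / 2 * (k * d)"
    using \<delta> nonneg k0 by (intro mult_right_mono; simp)+
  have "0 \<le> k * d" "0 \<le> \<delta> * w" using nonneg k0 \<delta> by simp_all
  have combine: "(x + y + z) / 2 \<le> a / 2 + p + q + r + s - t"
    if "x \<le> 1 / 2 * a" "y \<le> 1 / 2 * r" "- a / 4 - q / 4 \<le> p" "t \<le> r / 2 + s / 2" "z \<le> q + s"
      "0 \<le> r" "0 \<le> q" for x y z p q r s t :: real
    using that by (simp add: field_simps)
  have "\<delta> / 2 * (a + k * d + w / k) = (\<delta> * a + \<delta> * (k * d) + \<delta> * (w / k)) / 2"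
    by (simp add: algebra_simps add_divide_distrib)
  also have "\<dots> \<le> a / 2 + 1 / 2 * (\<delta> * b) + \<delta> * w + k * d + inverse \<kappa> * w - inverse \<kappa> * k * e"
    by (rule combine[OF damp dev coupling vel]) fact+
  also have "\<dots> = 1 / 2 * (a + \<delta> * b) + (e + \<delta> * w) - (e + (- k) * d) + inverse \<kappa> * (w + (- k) * e)"
    by (simp add: algebra_simps)
  finally show ?thesis .
qed

text \<open>
  The pair \<open>\<tau> = \<sigma> + \<delta> \<rho>\<close>, \<open>v = u - k div \<sigma>\<close>, where \<open>\<rho>\<close> is the bounded lift with \<open>div \<rho> = u\<close> and
  \<open>k = min \<kappa> 1\<close>. Since \<open>\<rho>\<close> does not depend on \<open>\<kappa>\<close>, neither does the resulting constant.
\<close>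

lemma stable_test_pair:
  fixes \<Omega> :: "(real^'n::finite) set"
  assumes \<Omega>: "open \<Omega>" "bounded \<Omega>" "\<Omega> \<noteq> {}"
  obtains \<gamma> where "0 < \<gamma>"
    "\<And>\<kappa> \<sigma> u. 0 < \<kappa> \<Longrightarrow> \<sigma> \<in> stress_space \<Omega> \<Longrightarrow> u \<in> velocity_space \<Omega> \<Longrightarrow>
      \<exists>\<tau>\<in>stress_space \<Omega>. \<exists>v\<in>velocity_space \<Omega>.
        \<gamma> * energy \<kappa> \<Omega> (\<sigma>, u) \<le> A_form \<kappa> \<Omega> (\<sigma>, u) (\<tau>, v) \<and>
        energy \<kappa> \<Omega> (\<tau>, v) \<le> 4 * energy \<kappa> \<Omega> (\<sigma>, u)"
proof -
  obtain C where C: "0 \<le> C" and inverse_div: "\<And>u. u \<in> L2 \<Omega> \<Longrightarrow> \<exists>\<tau>\<in>stress_space \<Omega>. has_L2_row_div \<Omega> \<tau> u \<and>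
      L2_inner \<Omega> (\<lambda>x. dev (\<tau> x)) (\<lambda>x. dev (\<tau> x)) \<le> C * L2_inner \<Omega> u u"
    using symmetric_right_inverse_of_divergence[OF \<Omega>] by blast
  \<comment> \<open>Small enough that the deviator of \<open>\<delta> \<rho>\<close> is absorbed by the two diagonal terms.\<close>
  define \<delta> where "\<delta> = 1 / (2 + C)"
  have \<delta>: "0 < \<delta>" "\<delta> \<le> 1 / 2" "\<delta> * C \<le> 1" using C by (auto simp: \<delta>_def field_simps)
  show thesis
  proof (rule that[of "\<delta> / 2"])
    fix \<kappa> :: real and \<sigma> :: "real^'n \<Rightarrow> real^'n^'n" and u :: "real^'n \<Rightarrow> real^'n"
    assume \<kappa>: "0 < \<kappa>" and \<sigma>: "\<sigma> \<in> stress_space \<Omega>" and "u \<in> velocity_space \<Omega>"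
    then have u: "u \<in> L2 \<Omega>" by (simp add: velocity_space_def)
    obtain \<rho> where \<rho>: "\<rho> \<in> stress_space \<Omega>" and div\<rho>: "has_L2_row_div \<Omega> \<rho> u"
      and dev\<rho>: "L2_inner \<Omega> (\<lambda>x. dev (\<rho> x)) (\<lambda>x. dev (\<rho> x)) \<le> C * L2_inner \<Omega> u u"
      using inverse_div[OF u] by blast
    define k where "k = kappa_tilde \<kappa>"
    have k: "k = min \<kappa> 1" "0 < k" "k \<le> 1" using \<kappa> by (auto simp: k_def kappa_tilde_def)
    define \<tau> where "\<tau> = (\<lambda>x. \<sigma> x + \<delta> *\<^sub>R \<rho> x)"
    define v where "v = (\<lambda>x. u x + (- k) *\<^sub>R row_div \<Omega> \<sigma> x)"
    have \<tau>: "\<tau> \<in> stress_space \<Omega>" unfolding \<tau>_def by (rule stress_space_axpy[OF \<Omega>(1,2) \<sigma> \<rho>])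
    note L2 = stress_space_L2[OF \<sigma>] stress_space_L2[OF \<rho>] stress_space_L2[OF \<tau>] u
    have v: "v \<in> L2 \<Omega>" unfolding v_def by (intro L2_add L2_scaleR L2)
    define div\<tau> where "div\<tau> = (\<lambda>x. row_div \<Omega> \<sigma> x + \<delta> *\<^sub>R u x)"
    have div\<tau>: "div\<tau> \<in> L2 \<Omega>" unfolding div\<tau>_def by (intro L2_add L2_scaleR L2)
    have AE\<tau>: "AE x in lebesgue_on \<Omega>. row_div \<Omega> \<tau> x = div\<tau> x"
      unfolding \<tau>_def div\<tau>_def by (rule row_div_axpy[OF \<Omega>(1,2) \<sigma> \<rho> div\<rho>])
    define a b c d e w where "a = L2_inner \<Omega> (\<lambda>x. dev (\<sigma> x)) (\<lambda>x. dev (\<sigma> x))"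
      and "b = L2_inner \<Omega> (\<lambda>x. dev (\<sigma> x)) (\<lambda>x. dev (\<rho> x))"
      and "c = L2_inner \<Omega> (\<lambda>x. dev (\<rho> x)) (\<lambda>x. dev (\<rho> x))"
      and "d = L2_inner \<Omega> (row_div \<Omega> \<sigma>) (row_div \<Omega> \<sigma>)"
      and "e = L2_inner \<Omega> (row_div \<Omega> \<sigma>) u"
      and "w = L2_inner \<Omega> u u"
    note abbrev = a_def b_def c_def d_def e_def w_def
    have nonneg: "0 \<le> a" "0 \<le> c" "0 \<le> d" "0 \<le> w" by (simp_all add: abbrev L2_inner_nonneg)
    have dev\<tau>2: "L2_inner \<Omega> (\<lambda>x. dev (\<tau> x)) (\<lambda>x. dev (\<tau> x)) = a + 2 * \<delta> * b + \<delta>\<^sup>2 * c"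
      using L2_inner_axpy_square[OF L2(2) L2(5)] by (simp add: \<tau>_def dev_axpy abbrev)
    have div\<tau>2: "L2_inner \<Omega> (row_div \<Omega> \<tau>) (row_div \<Omega> \<tau>) = d + 2 * \<delta> * e + \<delta>\<^sup>2 * w"
      using L2_inner_cong_AE[OF L2(9) div\<tau> L2(9) div\<tau> AE\<tau> AE\<tau>] L2_inner_axpy_square[OF L2(3) u]
      by (simp add: div\<tau>_def abbrev)
    have v2: "L2_inner \<Omega> v v = w + 2 * (- k) * e + k\<^sup>2 * d"
      using L2_inner_axpy_square[OF u L2(3), of "- k"]
      by (simp add: v_def abbrev L2_inner_commute[of _ u "row_div \<Omega> \<sigma>"])
    have "L2_inner \<Omega> (row_div \<Omega> \<tau>) u = e + \<delta> * w"
      using L2_inner_cong_AE[OF L2(9) div\<tau> u u AE\<tau>] L2_inner_axpy_left[OF L2(3) u u]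
      by (simp add: div\<tau>_def abbrev)
    moreover have "L2_inner \<Omega> (\<lambda>x. dev (\<sigma> x)) (\<lambda>x. dev (\<tau> x)) = a + \<delta> * b"
      using L2_inner_axpy_right[OF L2(2) L2(5) L2(2)] by (simp add: \<tau>_def dev_axpy abbrev)
    moreover have "L2_inner \<Omega> (row_div \<Omega> \<sigma>) v = e + (- k) * d"
      using L2_inner_axpy_right[OF u L2(3) L2(3), of "- k"] by (simp add: v_def abbrev)
    moreover have "L2_inner \<Omega> (\<lambda>x. inverse \<kappa> *\<^sub>R u x) v = inverse \<kappa> * (w + (- k) * e)"
    proof -
      have "L2_inner \<Omega> (\<lambda>x. inverse \<kappa> *\<^sub>R u x) v = inverse \<kappa> * L2_inner \<Omega> u v"
        by (simp add: L2_inner_def)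
      then show ?thesis
        using L2_inner_axpy_right[OF u L2(3) u, of "- k"] by (simp add: v_def abbrev L2_inner_commute[of _ u "row_div \<Omega> \<sigma>"])
    qed
    ultimately have A: "A_form \<kappa> \<Omega> (\<sigma>, u) (\<tau>, v) =
        1 / 2 * (a + \<delta> * b) + (e + \<delta> * w) - (e + (- k) * d) + inverse \<kappa> * (w + (- k) * e)"
      by (simp add: A_form_def)
    have N: "energy \<kappa> \<Omega> (\<sigma>, u) = a + k * d + w / k"
      by (simp add: energy_eq[OF \<kappa>] abbrev k_def)
    have "0 \<le> a + 2 * \<delta> * b + \<delta>\<^sup>2 * c"
      unfolding dev\<tau>2[symmetric] by (rule L2_inner_nonneg)
    moreover have "0 \<le> d + 2 * (- inverse \<kappa>) * e + (- inverse \<kappa>)\<^sup>2 * w"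
      unfolding abbrev L2_inner_axpy_square[OF L2(3) u, symmetric] by (rule L2_inner_nonneg)
    ultimately have lower: "\<delta> / 2 * energy \<kappa> \<Omega> (\<sigma>, u) \<le> A_form \<kappa> \<Omega> (\<sigma>, u) (\<tau>, v)"
      unfolding A N using dev\<rho> nonneg by (intro test_pair_lower_bound[OF \<kappa> k(1) \<delta>]) (auto simp: abbrev)
    have "energy \<kappa> \<Omega> (\<tau>, v) \<le> 4 * energy \<kappa> \<Omega> (\<sigma>, u)"
    proof -
      have "0 \<le> a + 2 * (- \<delta>) * b + (- \<delta>)\<^sup>2 * c"
        unfolding abbrev L2_inner_axpy_square[OF L2(2) L2(5), symmetric] by (rule L2_inner_nonneg)
      moreover have "\<delta>\<^sup>2 * c \<le> w / 2"
      proof -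
        have "\<delta>\<^sup>2 * c \<le> \<delta>\<^sup>2 * (C * w)" using dev\<rho> by (intro mult_left_mono) (auto simp: abbrev)
        also have "\<dots> = \<delta> * w * (\<delta> * C)" by (simp add: power2_eq_square)
        also have "\<dots> \<le> \<delta> * w * 1" using \<delta> nonneg by (intro mult_left_mono) auto
        also have "\<dots> \<le> 1 / 2 * w" using \<delta> nonneg by (simp only: mult_1_right) (intro mult_right_mono; simp)
        finally show ?thesis by simp
      qed
      ultimately have 1: "a + 2 * \<delta> * b + \<delta>\<^sup>2 * c \<le> 2 * a + w" by simp
      have "0 \<le> d + 2 * (- \<delta>) * e + (- \<delta>)\<^sup>2 * w"
        unfolding abbrev L2_inner_axpy_square[OF L2(3) u, symmetric] by (rule L2_inner_nonneg)
      moreover have "\<delta>\<^sup>2 * w \<le> w / 2"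
      proof -
        have "\<delta>\<^sup>2 \<le> (1 / 2)\<^sup>2" using \<delta> by (intro power_mono) auto
        from mult_right_mono[OF this nonneg(4)] show ?thesis using nonneg by (simp add: power2_eq_square)
      qed
      ultimately have "d + 2 * \<delta> * e + \<delta>\<^sup>2 * w \<le> 2 * d + w" by simp
      then have "k * (d + 2 * \<delta> * e + \<delta>\<^sup>2 * w) \<le> k * (2 * d + w)" using k by simp
      moreover have "k * w \<le> w" using k nonneg by (simp add: mult_left_le_one_le)
      ultimately have 2: "k * (d + 2 * \<delta> * e + \<delta>\<^sup>2 * w) \<le> 2 * (k * d) + w"
        by (simp add: algebra_simps)
      have "0 \<le> w + 2 * k * e + k\<^sup>2 * d"
        using L2_inner_axpy_square[OF u L2(3), of k] L2_inner_nonneg[of \<Omega> "\<lambda>x. u x + k *\<^sub>R row_div \<Omega> \<sigma> x"]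
        by (simp add: abbrev L2_inner_commute[of _ u "row_div \<Omega> \<sigma>"])
      then have "(w + 2 * (- k) * e + k\<^sup>2 * d) / k \<le> (2 * w + 2 * k\<^sup>2 * d) / k"
        by (intro divide_right_mono less_imp_le[OF k(2)]) (simp add: algebra_simps)
      then have 3: "(w + 2 * (- k) * e + k\<^sup>2 * d) / k \<le> 2 * (w / k) + 2 * (k * d)"
        using k by (simp add: add_divide_distrib power2_eq_square)
      have "energy \<kappa> \<Omega> (\<tau>, v) = (a + 2 * \<delta> * b + \<delta>\<^sup>2 * c) + k * (d + 2 * \<delta> * e + \<delta>\<^sup>2 * w)
          + (w + 2 * (- k) * e + k\<^sup>2 * d) / k"
        by (simp only: energy_eq[OF \<kappa>] dev\<tau>2 div\<tau>2 v2 k_def[symmetric])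
      also have "\<dots> \<le> (2 * a + w) + (2 * (k * d) + w) + (2 * (w / k) + 2 * (k * d))"
        by (intro add_mono 1 2 3)
      also have "\<dots> \<le> 4 * (a + k * d + w / k)"
      proof -
        have "w \<le> w / k" using k nonneg by (simp only: pos_le_divide_eq mult_left_le)
        then show ?thesis using nonneg(1) unfolding distrib_left by linarith
      qed
      finally show ?thesis by (simp only: N)
    qed
    with lower \<tau> v show "\<exists>\<tau>\<in>stress_space \<Omega>. \<exists>v\<in>velocity_space \<Omega>.
        \<delta> / 2 * energy \<kappa> \<Omega> (\<sigma>, u) \<le> A_form \<kappa> \<Omega> (\<sigma>, u) (\<tau>, v) \<and>
        energy \<kappa> \<Omega> (\<tau>, v) \<le> 4 * energy \<kappa> \<Omega> (\<sigma>, u)"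
      by (auto simp: velocity_space_def)
  qed (use \<delta> in simp)
qed

text \<open>
  Vanishing almost everywhere passes to the chosen divergence only through the uniqueness of weak divergences.
\<close>

lemma A_form_zero_right:
  assumes "open \<Omega>" "bounded \<Omega>" and \<tau>: "\<tau> \<in> stress_space \<Omega>" and "v \<in> velocity_space \<Omega>"
    and zero: "AE x in lebesgue_on \<Omega>. \<tau> x = 0 \<and> v x = 0"
  shows "A_form \<kappa> \<Omega> p (\<tau>, v) = 0"
proof -
  obtain \<sigma> u where p: "p = (\<sigma>, u)" by fastforce
  have \<tau>0: "AE x in lebesgue_on \<Omega>. \<tau> x = 0" and v0: "AE x in lebesgue_on \<Omega>. v x = 0"
    using zero by (auto elim: eventually_mono)
  have "has_L2_row_div \<Omega> \<tau> (\<lambda>x. 0)"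
    unfolding has_L2_row_div_def has_weak_div_def
  proof (intro conjI allI ballI)
    show "(\<lambda>x. 0) \<in> L2 \<Omega>" by (simp add: L2_def)
    fix i \<phi>
    have "(LINT x|lebesgue_on \<Omega>. \<tau> x $ i \<bullet> grad \<phi> x) = 0"
      by (rule integral_eq_zero_AE) (use \<tau>0 in \<open>auto elim: eventually_mono\<close>)
    then show "(LINT x|lebesgue_on \<Omega>. \<tau> x $ i \<bullet> grad \<phi> x) = - (LINT x|lebesgue_on \<Omega>. 0 $ i * \<phi> x)"
      by simp
  qed
  then have div0: "AE x in lebesgue_on \<Omega>. row_div \<Omega> \<tau> x = 0"
    by (rule row_div_AE_eq[OF assms(1,2) \<tau>])
  have "L2_inner \<Omega> f (\<lambda>x. dev (\<tau> x)) = 0" for f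
    unfolding L2_inner_def
    by (rule integral_eq_zero_AE) (use \<tau>0 in \<open>auto elim!: eventually_mono simp: dev_def trace_def\<close>)
  moreover have "L2_inner \<Omega> (row_div \<Omega> \<tau>) f = 0" for f
    unfolding L2_inner_def
    by (rule integral_eq_zero_AE) (use div0 in \<open>auto elim!: eventually_mono\<close>)
  moreover have "L2_inner \<Omega> f v = 0" for f
    unfolding L2_inner_def
    by (rule integral_eq_zero_AE) (use v0 in \<open>auto elim!: eventually_mono\<close>)
  ultimately show ?thesis by (simp add: A_form_def p)
qed

theorem lemma2p3:
  fixes \<Omega> :: "(real^'n::finite) set"
  assumes "CARD('n) \<in> {2, 3}"
    and "polyhedral_lipschitz_domain \<Omega>"
    and "simply_connected \<Omega>"
  shows "\<exists>\<beta>>0. \<forall>\<kappa>>0.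
    (INF p\<in>nonzero_pairs \<Omega>. SUP q\<in>nonzero_pairs \<Omega>.
       ereal (A_form \<kappa> \<Omega> p q / (pair_norm \<kappa> \<Omega> p * pair_norm \<kappa> \<Omega> q))) \<ge> ereal \<beta>"
proof -
  have \<Omega>: "open \<Omega>" "bounded \<Omega>" "connected \<Omega>" "\<Omega> \<noteq> {}"
    using assms(2) by (auto simp: polyhedral_lipschitz_domain_def)
  obtain \<gamma> where \<gamma>: "0 < \<gamma>" and test: "\<And>\<kappa> \<sigma> u. 0 < \<kappa> \<Longrightarrow> \<sigma> \<in> stress_space \<Omega> \<Longrightarrow> u \<in> velocity_space \<Omega> \<Longrightarrow>
      \<exists>\<tau>\<in>stress_space \<Omega>. \<exists>v\<in>velocity_space \<Omega>.
        \<gamma> * energy \<kappa> \<Omega> (\<sigma>, u) \<le> A_form \<kappa> \<Omega> (\<sigma>, u) (\<tau>, v) \<and>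
        energy \<kappa> \<Omega> (\<tau>, v) \<le> 4 * energy \<kappa> \<Omega> (\<sigma>, u)"
    using stable_test_pair[OF \<Omega>(1,2,4)] by blast
  have bound: "\<exists>q\<in>nonzero_pairs \<Omega>. \<gamma> / 4 \<le> A_form \<kappa> \<Omega> p q / (pair_norm \<kappa> \<Omega> p * pair_norm \<kappa> \<Omega> q)"
    if \<kappa>: "0 < \<kappa>" and p: "p \<in> nonzero_pairs \<Omega>" for \<kappa> p
  proof -
    obtain \<sigma> u where \<sigma>u: "p = (\<sigma>, u)" by fastforce
    have "\<sigma> \<in> stress_space \<Omega>" "u \<in> velocity_space \<Omega>"
      using p by (auto simp: \<sigma>u nonzero_pairs_def)
    from test[OF \<kappa> this] obtain \<tau> v where \<tau>: "\<tau> \<in> stress_space \<Omega>" and v: "v \<in> velocity_space \<Omega>"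
      and A: "\<gamma> * energy \<kappa> \<Omega> p \<le> A_form \<kappa> \<Omega> p (\<tau>, v)"
      and N: "energy \<kappa> \<Omega> (\<tau>, v) \<le> 4 * energy \<kappa> \<Omega> p"
      unfolding \<sigma>u by blast
    have pos: "0 < energy \<kappa> \<Omega> p" by (rule energy_pos[OF \<Omega> \<kappa> p])
    then have "0 < A_form \<kappa> \<Omega> p (\<tau>, v)" using A \<gamma> by (meson less_le_trans mult_pos_pos)
    then have q: "(\<tau>, v) \<in> nonzero_pairs \<Omega>"
      using A_form_zero_right[OF \<Omega>(1,2) \<tau> v, of _ p] \<tau> v by (auto simp: nonzero_pairs_def)
    have norms: "0 < pair_norm \<kappa> \<Omega> p" "0 < pair_norm \<kappa> \<Omega> (\<tau>, v)"
      by (intro pair_norm_pos[OF \<kappa>] energy_pos[OF \<Omega> \<kappa>] p q)+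
    have "pair_norm \<kappa> \<Omega> p * pair_norm \<kappa> \<Omega> (\<tau>, v)
        \<le> sqrt (2 * energy \<kappa> \<Omega> p) * sqrt (2 * energy \<kappa> \<Omega> (\<tau>, v))"
      using norms pos by (intro mult_mono pair_norm_le) auto
    also have "\<dots> \<le> sqrt (2 * energy \<kappa> \<Omega> p) * sqrt (2 * (4 * energy \<kappa> \<Omega> p))"
      using N pos by (intro mult_left_mono) auto
    also have "\<dots> = sqrt ((4 * energy \<kappa> \<Omega> p)\<^sup>2)"
      by (simp add: power2_eq_square flip: real_sqrt_mult)
    also have "\<dots> = 4 * energy \<kappa> \<Omega> p" using pos by (subst real_sqrt_abs) simp
    finally have "\<gamma> / 4 * (pair_norm \<kappa> \<Omega> p * pair_norm \<kappa> \<Omega> (\<tau>, v)) \<le> \<gamma> / 4 * (4 * energy \<kappa> \<Omega> p)"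
      using \<gamma> by (intro mult_left_mono) auto
    also have "\<dots> \<le> A_form \<kappa> \<Omega> p (\<tau>, v)" using A by simp
    finally have "\<gamma> / 4 \<le> A_form \<kappa> \<Omega> p (\<tau>, v) / (pair_norm \<kappa> \<Omega> p * pair_norm \<kappa> \<Omega> (\<tau>, v))"
      using norms by (simp add: pos_le_divide_eq)
    with q show ?thesis by blast
  qed
  show ?thesis
  proof (intro exI[of _ "\<gamma> / 4"] conjI allI impI)
    show "0 < \<gamma> / 4" using \<gamma> by simp
    fix \<kappa> :: real assume \<kappa>: "0 < \<kappa>"
    show "ereal (\<gamma> / 4) \<le> (INF p\<in>nonzero_pairs \<Omega>. SUP q\<in>nonzero_pairs \<Omega>.
       ereal (A_form \<kappa> \<Omega> p q / (pair_norm \<kappa> \<Omega> p * pair_norm \<kappa> \<Omega> q)))"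
    proof (rule INF_greatest)
      fix p assume "p \<in> nonzero_pairs \<Omega>"
      from bound[OF \<kappa> this] obtain q where "q \<in> nonzero_pairs \<Omega>"
        "\<gamma> / 4 \<le> A_form \<kappa> \<Omega> p q / (pair_norm \<kappa> \<Omega> p * pair_norm \<kappa> \<Omega> q)" by blast
      then show "ereal (\<gamma> / 4) \<le> (SUP q\<in>nonzero_pairs \<Omega>.
         ereal (A_form \<kappa> \<Omega> p q / (pair_norm \<kappa> \<Omega> p * pair_norm \<kappa> \<Omega> q)))"
        by (intro SUP_upper2[of q]) auto
    qed
  qed
qed

end
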